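(* The coverability problem is undecidable for cover-WSTS: there is no algorithm that, given a cover-WSTS $\mathcal{S}=(X,\Sigma,\to,\leq,x_0)$ (effectively presented, e.g. by a counter machine extended as a transition system) and states $x,y\in X$, decides whether $y$ is coverable from $x$, i.e. whether $y\in\downarrow\mathrm{Post}^*(x)$.
   Context: $\mathrm{Post}^*(x)$ is the set of states reachable from $x$ and $\downarrow Y=\{z\mid z\leq y\text{ for some }y\in Y\}$. $\mathcal{S}$ (state set $X$, finite alphabet $\Sigma$, labelled transitions $\to$, quasi-ordering $\leq$, initial state $x_0$) is cover-monotone if for all $y_1\in\downarrow\mathrm{Post}^*(x_0)$ and $x_1,x_2$ with $x_1\leq y_1$ and $x_1\to x_2$ there is $y_2$ with $y_1\xrightarrow{*}y_2$ and $x_2\leq y_2$. A cover-WSTS is a finitely branching (each set of successors finite) cover-monotone system with $(X,\leq)$ a well-quasi-ordering. *)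

theory Defs
  imports Main "HOL-Library.Nat_Bijection"
begin

section \<open>Ordered labelled transition systems and cover-WSTS\<close>

record ('x, 'a) lts =
  states :: "'x set"
  alphabet :: "'a set"
  transitions :: "('x \<times> 'a \<times> 'x) set"
  leq :: "'x \<Rightarrow> 'x \<Rightarrow> bool"
  init :: 'x

definition quasi_order_on :: "'x set \<Rightarrow> ('x \<Rightarrow> 'x \<Rightarrow> bool) \<Rightarrow> bool" where
  "quasi_order_on X le \<longleftrightarrow> reflp_on X le \<and> transp_on X le"

definition wqo_on :: "'x set \<Rightarrow> ('x \<Rightarrow> 'x \<Rightarrow> bool) \<Rightarrow> bool" where
  "wqo_on X le \<longleftrightarrow> quasi_order_on X le \<and>
     (\<forall>s :: nat \<Rightarrow> 'x. range s \<subseteq> X \<longrightarrow> (\<exists>i j. i < j \<and> le (s i) (s j)))"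

definition ordered_lts :: "('x, 'a) lts \<Rightarrow> bool" where
  "ordered_lts S \<longleftrightarrow>
     finite (alphabet S) \<and>
     transitions S \<subseteq> states S \<times> alphabet S \<times> states S \<and>
     quasi_order_on (states S) (leq S) \<and>
     init S \<in> states S"

definition step_rel :: "('x, 'a) lts \<Rightarrow> ('x \<times> 'x) set" where
  "step_rel S = {(x, y). \<exists>a. (x, a, y) \<in> transitions S}"

definition Post_star :: "('x, 'a) lts \<Rightarrow> 'x \<Rightarrow> 'x set" where
  "Post_star S x = {y. (x, y) \<in> (step_rel S)\<^sup>*}"

definition down :: "('x, 'a) lts \<Rightarrow> 'x set \<Rightarrow> 'x set" where
  "down S Y = {z \<in> states S. \<exists>y\<in>Y. leq S z y}"

definition coverable :: "('x, 'a) lts \<Rightarrow> 'x \<Rightarrow> 'x \<Rightarrow> bool" where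
  "coverable S x y \<longleftrightarrow> y \<in> down S (Post_star S x)"

definition finitely_branching :: "('x, 'a) lts \<Rightarrow> bool" where
  "finitely_branching S \<longleftrightarrow> (\<forall>x\<in>states S. finite {y. (x, y) \<in> step_rel S})"

definition cover_monotone :: "('x, 'a) lts \<Rightarrow> bool" where
  "cover_monotone S \<longleftrightarrow>
     (\<forall>y1 \<in> down S (Post_star S (init S)). \<forall>x1 \<in> states S. \<forall>x2 \<in> states S.
        leq S x1 y1 \<and> (x1, x2) \<in> step_rel S \<longrightarrow>
        (\<exists>y2. (y1, y2) \<in> (step_rel S)\<^sup>* \<and> leq S x2 y2))"

definition cover_WSTS :: "('x, 'a) lts \<Rightarrow> bool" where
  "cover_WSTS S \<longleftrightarrow>
     ordered_lts S \<and> finitely_branching S \<and> cover_monotone S \<and> wqo_on (states S) (leq S)"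


section \<open>Algorithms: partial recursive functions\<close>

text \<open>
  Algorithms are Kleene's mu-recursive programs. The relation \<open>eval f xs y\<close> says that
  program \<open>f\<close> halts on the argument list \<open>xs\<close> with output \<open>y\<close>.
  Arities are not declared: \<open>Zero\<close> is the constant zero of every arity, \<open>Proj i\<close> a projection at
  every arity above \<open>i\<close>, and a program has no value on an argument list it does not fit.
\<close>

datatype recf =
    Zero
  | Succ
  | Proj nat
  | Comp recf "recf list"
  | PrimRec recf recf
  | Mu recf

inductive eval :: "recf \<Rightarrow> nat list \<Rightarrow> nat \<Rightarrow> bool" where
  eval_Zero: "eval Zero xs 0"
| eval_Succ: "eval Succ [x] (Suc x)"
| eval_Proj: "i < length xs \<Longrightarrow> eval (Proj i) xs (xs ! i)"
| eval_Comp: "list_all2 (\<lambda>g y. eval g xs y) gs ys \<Longrightarrow> eval f ys z \<Longrightarrow> eval (Comp f gs) xs z"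
| eval_PrimRec_0: "eval f xs y \<Longrightarrow> eval (PrimRec f g) (0 # xs) y"
| eval_PrimRec_Suc:
    "eval (PrimRec f g) (n # xs) r \<Longrightarrow> eval g (n # r # xs) y \<Longrightarrow> eval (PrimRec f g) (Suc n # xs) y"
| eval_Mu:
    "eval f (n # xs) 0 \<Longrightarrow> (\<And>i. i < n \<Longrightarrow> \<exists>y. eval f (i # xs) (Suc y)) \<Longrightarrow> eval (Mu f) xs n"

fun recf_code :: "recf \<Rightarrow> nat" where
  "recf_code Zero = prod_encode (0, 0)"
| "recf_code Succ = prod_encode (1, 0)"
| "recf_code (Proj i) = prod_encode (2, i)"
| "recf_code (Comp f gs) = prod_encode (3, prod_encode (recf_code f, list_encode (map recf_code gs)))"
| "recf_code (PrimRec f g) = prod_encode (4, prod_encode (recf_code f, recf_code g))"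
| "recf_code (Mu f) = prod_encode (5, recf_code f)"


section \<open>The coverability problem for presented systems\<close>

text \<open>
  A presentation format \<open>P\<close> relates codes \<open>c\<close> to the systems they present; \<open>enc\<close> codes states.
  A decision procedure has to be correct on every code of a cover-WSTS and every pair of its
  states. On all other inputs it may do anything, including run forever.
\<close>

definition decides_coverability ::
  "recf \<Rightarrow> ('x \<Rightarrow> nat) \<Rightarrow> (nat \<Rightarrow> ('x, 'a) lts \<Rightarrow> bool) \<Rightarrow> bool" where
  "decides_coverability D enc P \<longleftrightarrow>
     (\<forall>c S. P c S \<and> cover_WSTS S \<longrightarrow>
        (\<forall>x\<in>states S. \<forall>y\<in>states S.
           eval D [c, enc x, enc y] (if coverable S x y then 1 else 0)))"


subsection \<open>Systems presented by programs\<close>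

text \<open>
  States and labels are coded by natural numbers. The system is given by programs deciding the
  state set and the quasi-ordering and a program listing the finitely many outgoing transitions
  \<open>(label, target)\<close> of a state, together with its alphabet and its initial state.
\<close>

definition program_presents :: "nat \<Rightarrow> (nat, nat) lts \<Rightarrow> bool" where
  "program_presents c S \<longleftrightarrow>
     (\<exists>m l t A.
        c = list_encode [recf_code m, recf_code l, recf_code t, list_encode A, init S] \<and>
        (\<forall>x. eval m [x] (if x \<in> states S then 1 else 0)) \<and>
        (\<forall>x\<in>states S. \<forall>y\<in>states S. eval l [x, y] (if leq S x y then 1 else 0)) \<and>
        (\<forall>x\<in>states S. \<exists>ts. eval t [x] (list_encode (map prod_encode ts)) \<and>
                            set ts = {(a, y). (x, a, y) \<in> transitions S}) \<and>
        set A = alphabet S)"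


subsection \<open>Systems presented by counter machines\<close>

datatype counter_op = Inc nat | Dec nat | Noop

text \<open>
  Control states are the numbers below \<open>ncontrol\<close>, counters the numbers below \<open>ncounters\<close>.
  A rule \<open>(q, op, Z, q')\<close> is enabled if all counters listed in \<open>Z\<close> are zero and \<open>op\<close> can be
  performed (\<open>Dec\<close> needs a positive counter).
\<close>

record counter_machine =
  ncontrol :: nat
  ncounters :: nat
  rules :: "(nat \<times> counter_op \<times> nat list \<times> nat) list"
  start :: nat

definition counter_ops :: "nat \<Rightarrow> counter_op set" where
  "counter_ops k = insert Noop (Inc ` {..<k} \<union> Dec ` {..<k})"

definition wf_cm :: "counter_machine \<Rightarrow> bool" where
  "wf_cm M \<longleftrightarrow> start M < ncontrol M \<and>
     (\<forall>(q, op, Z, q') \<in> set (rules M).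
        q < ncontrol M \<and> q' < ncontrol M \<and> op \<in> counter_ops (ncounters M) \<and>
        set Z \<subseteq> {..<ncounters M})"

fun apply_op :: "counter_op \<Rightarrow> nat list \<Rightarrow> nat list \<Rightarrow> bool" where
  "apply_op (Inc i) v w \<longleftrightarrow> w = v[i := Suc (v ! i)]"
| "apply_op (Dec i) v w \<longleftrightarrow> 0 < v ! i \<and> w = v[i := v ! i - 1]"
| "apply_op Noop v w \<longleftrightarrow> w = v"

definition cm_configs :: "counter_machine \<Rightarrow> (nat \<times> nat list) set" where
  "cm_configs M = {(q, v). q < ncontrol M \<and> length v = ncounters M}"

definition cm_lts :: "counter_machine \<Rightarrow> (nat \<times> nat list, counter_op \<times> nat set) lts" where
  "cm_lts M =
     \<lparr>states = cm_configs M,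
      alphabet = counter_ops (ncounters M) \<times> Pow {..<ncounters M},
      transitions = {((q, v), (op, set Z), (q', w)) |q v op Z q' w.
        (q, op, Z, q') \<in> set (rules M) \<and> length v = ncounters M \<and>
        (\<forall>i\<in>set Z. v ! i = 0) \<and> apply_op op v w},
      leq = (\<lambda>(q, v) (q', w). q = q' \<and> list_all2 (\<le>) v w),
      init = (start M, replicate (ncounters M) 0)\<rparr>"

fun op_code :: "counter_op \<Rightarrow> nat" where
  "op_code (Inc i) = prod_encode (0, i)"
| "op_code (Dec i) = prod_encode (1, i)"
| "op_code Noop = prod_encode (2, 0)"

fun rule_code :: "nat \<times> counter_op \<times> nat list \<times> nat \<Rightarrow> nat" where
  "rule_code (q, op, Z, q') = list_encode [q, op_code op, list_encode Z, q']"

definition cm_code :: "counter_machine \<Rightarrow> nat" where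
  "cm_code M =
     list_encode [ncontrol M, ncounters M, list_encode (map rule_code (rules M)), start M]"

fun config_code :: "nat \<times> nat list \<Rightarrow> nat" where
  "config_code (q, v) = prod_encode (q, list_encode v)"

definition cm_presents :: "nat \<Rightarrow> (nat \<times> nat list, counter_op \<times> nat set) lts \<Rightarrow> bool" where
  "cm_presents c S \<longleftrightarrow> (\<exists>M. wf_cm M \<and> c = cm_code M \<and> S = cm_lts M)"

end

theory Submission
  imports Defs
begin

text \<open>
  A fixed system with varying start state already has an undecidable coverability problem.
  Evaluation of mu-recursive programs is a set of Horn clauses over terms built from \<open>0\<close>, \<open>Suc\<close>
  and pairing, so proof search for it is a rewriting relation on numbers given by finitely many
  pairs of patterns. This relation is simulated by a program-presented system that enumerates the
  substitutions, and by a nondeterministic counter machine with zero tests that guesses them.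
  In both, the initial state is a dead end that serves as the target: cover-monotonicity only
  constrains the states below those reachable from the initial one, so it imposes nothing on the
  simulation. A decision procedure would then decide whether the program with code \<open>e\<close>
  yields \<open>0\<close> on \<open>e\<close>, which fails for the code of that decision.
\<close>


section \<open>Evaluation as rewriting of numbers\<close>

text \<open>Guessing replaces a universal program. Intermediate results, such as the values of the
  inner programs of a composition, are variables that occur only on the right of a rule, so the
  substitution supplies them. Only evaluating patterns and comparing numbers has to be implemented.
  Wrong guesses do no harm, because a derivation that uses up all goals can be read backwards as a
  proof of \<open>eval\<close>. With the system fixed, its code is a constant and the start state is
  a pattern in the number to be rewritten, so the diagonal argument needs no program that builds
  systems. A rule has infinitely many instances, which conflicts with finite branching, and counters
  cannot unpair. Both obstacles are met by counting up through codes in single steps and testing a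
  guess afterwards. The target makes covering a reachability question: in one system
  \<open>0\<close> is comparable only to itself, in the other the initial configuration has zero
  counters and lies below every configuration with its control state.\<close>

datatype pat = PVar nat | PZero | PSuc pat | PPair pat pat

primrec val :: "(nat \<Rightarrow> nat) \<Rightarrow> pat \<Rightarrow> nat" where
  "val \<rho> (PVar i) = \<rho> i"
| "val \<rho> PZero = 0"
| "val \<rho> (PSuc t) = Suc (val \<rho> t)"
| "val \<rho> (PPair t u) = prod_encode (val \<rho> t, val \<rho> u)"

primrec vars :: "pat \<Rightarrow> nat set" where
  "vars (PVar i) = {i}"
| "vars PZero = {}"
| "vars (PSuc t) = vars t"
| "vars (PPair t u) = vars t \<union> vars u"

lemma finite_vars: "finite (vars t)"
  by (induction t) auto

lemma val_cong: "(\<And>i. i \<in> vars t \<Longrightarrow> \<rho> i = \<rho>' i) \<Longrightarrow> val \<rho> t = val \<rho>' t"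
  by (induction t) auto

definition rewr :: "(pat \<times> pat) list \<Rightarrow> (nat \<times> nat) set" where
  "rewr R = {(val \<rho> l, val \<rho> r) |\<rho> l r. (l, r) \<in> set R}"

primrec pnum :: "nat \<Rightarrow> pat" where
  "pnum 0 = PZero"
| "pnum (Suc n) = PSuc (pnum n)"

lemma val_pnum [simp]: "val \<rho> (pnum n) = n"
  by (induction n) auto

lemma vars_pnum [simp]: "vars (pnum n) = {}"
  by (induction n) auto

text \<open>\<open>list_encode\<close> sends \<open>[]\<close> to 0 and a cons to the successor of a
  pair, so \<open>PZero\<close> and \<open>pcons\<close> match list codes and rules can take lists
  apart.\<close>

abbreviation pcons :: "pat \<Rightarrow> pat \<Rightarrow> pat" where
  "pcons t u \<equiv> PSuc (PPair t u)"

definition pgoal :: "nat \<Rightarrow> pat \<Rightarrow> pat \<Rightarrow> pat \<Rightarrow> pat" where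
  "pgoal n t u w = PPair (pnum n) (PPair t (PPair u w))"

definition goal :: "nat \<Rightarrow> nat \<Rightarrow> nat \<Rightarrow> nat \<Rightarrow> nat" where
  "goal n x y z = prod_encode (n, prod_encode (x, prod_encode (y, z)))"

lemma val_pgoal [simp]: "val \<rho> (pgoal n t u w) = goal n (val \<rho> t) (val \<rho> u) (val \<rho> w)"
  by (simp add: pgoal_def goal_def)

lemma vars_pgoal [simp]: "vars (pgoal n t u w) = vars t \<union> vars u \<union> vars w"
  by (simp add: pgoal_def Un_assoc)

lemma goal_inject [simp]:
  "goal n x y z = goal n' x' y' z' \<longleftrightarrow> n = n' \<and> x = x' \<and> y = y' \<and> z = z'"
  by (simp add: goal_def)

text \<open>
  A number is read as a list of goals still to be proved. Goals with tag 0 are evaluations,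
  goals with tag 1 are pointwise evaluations of a list of programs, and goals with tag 2 say that
  a program has positive values at all first arguments below a bound. Each pair below replaces the
  first goal by the premises of one clause of \<^const>\<open>eval\<close>; variable 1 is the remaining list.
\<close>

definition eval_rules :: "(pat \<times> pat) list" where
  "eval_rules =
    [(pcons (pgoal 0 (PPair (pnum 0) PZero) (PVar 2) PZero) (PVar 1),
      PVar 1),
     (pcons (pgoal 0 (PPair (pnum 1) PZero) (pcons (PVar 2) PZero) (PSuc (PVar 2))) (PVar 1),
      PVar 1),
     (pcons (pgoal 0 (PPair (pnum 2) PZero) (pcons (PVar 2) (PVar 3)) (PVar 2)) (PVar 1),
      PVar 1),
     (pcons (pgoal 0 (PPair (pnum 2) (PSuc (PVar 2))) (pcons (PVar 3) (PVar 4)) (PVar 5)) (PVar 1),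
      pcons (pgoal 0 (PPair (pnum 2) (PVar 2)) (PVar 4) (PVar 5)) (PVar 1)),
     (pcons (pgoal 0 (PPair (pnum 3) (PPair (PVar 2) (PVar 3))) (PVar 4) (PVar 5)) (PVar 1),
      pcons (pgoal 1 (PVar 3) (PVar 4) (PVar 6))
        (pcons (pgoal 0 (PVar 2) (PVar 6) (PVar 5)) (PVar 1))),
     (pcons (pgoal 1 PZero (PVar 2) PZero) (PVar 1),
      PVar 1),
     (pcons (pgoal 1 (pcons (PVar 2) (PVar 3)) (PVar 4) (pcons (PVar 5) (PVar 6))) (PVar 1),
      pcons (pgoal 0 (PVar 2) (PVar 4) (PVar 5))
        (pcons (pgoal 1 (PVar 3) (PVar 4) (PVar 6)) (PVar 1))),
     (pcons (pgoal 0 (PPair (pnum 4) (PPair (PVar 2) (PVar 3))) (pcons PZero (PVar 4)) (PVar 5))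
        (PVar 1),
      pcons (pgoal 0 (PVar 2) (PVar 4) (PVar 5)) (PVar 1)),
     (pcons (pgoal 0 (PPair (pnum 4) (PPair (PVar 2) (PVar 3)))
          (pcons (PSuc (PVar 6)) (PVar 4)) (PVar 5)) (PVar 1),
      pcons (pgoal 0 (PPair (pnum 4) (PPair (PVar 2) (PVar 3)))
          (pcons (PVar 6) (PVar 4)) (PVar 7))
        (pcons (pgoal 0 (PVar 3) (pcons (PVar 6) (pcons (PVar 7) (PVar 4))) (PVar 5)) (PVar 1))),
     (pcons (pgoal 0 (PPair (pnum 5) (PVar 2)) (PVar 3) (PVar 4)) (PVar 1),
      pcons (pgoal 0 (PVar 2) (pcons (PVar 4) (PVar 3)) PZero)
        (pcons (pgoal 2 (PVar 2) (PVar 3) (PVar 4)) (PVar 1))),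
     (pcons (pgoal 2 (PVar 2) (PVar 3) PZero) (PVar 1),
      PVar 1),
     (pcons (pgoal 2 (PVar 2) (PVar 3) (PSuc (PVar 4))) (PVar 1),
      pcons (pgoal 0 (PVar 2) (pcons (PVar 4) (PVar 3)) (PSuc (PVar 5)))
        (pcons (pgoal 2 (PVar 2) (PVar 3) (PVar 4)) (PVar 1)))]"

text \<open>Variable 0 stays out so that the counter machine can keep the rewritten number in
  counter 0 and the substitution in counters 1 to 7.\<close>

lemma vars_eval_rules: "(l, r) \<in> set eval_rules \<Longrightarrow> vars l \<union> vars r \<subseteq> {1..7}"
  by (auto simp: eval_rules_def)

text \<open>The added head shifts positions by one, so a list gives the values of variables 1, 2,
  ... in order, with the pending goals first.\<close>

definition asg :: "nat list \<Rightarrow> nat \<Rightarrow> nat" where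
  "asg xs i = (0 # xs) ! i"

lemma rewr_eval_rulesI:
  assumes "n < length eval_rules" "a = val (asg xs) (fst (eval_rules ! n))"
    "b = val (asg xs) (snd (eval_rules ! n))"
  shows "(a, b) \<in> rewr eval_rules"
  using assms nth_mem[OF assms(1)] by (cases "eval_rules ! n") (auto simp: rewr_def)

text \<open>An arbitrary pending list \<open>k\<close> makes derivations composable: the premises of
  a clause are used up one after another, each with the later ones as part of its pending
  list.\<close>

lemma eval_rules_complete:
  assumes "eval f xs y"
  shows "(Suc (prod_encode (goal 0 (recf_code f) (list_encode xs) y, k)), k)
    \<in> (rewr eval_rules)\<^sup>*"
  using assms
proof (induction arbitrary: k)
  case (eval_Zero xs)
  show ?case
    by (rule r_into_rtrancl, rule rewr_eval_rulesI[where n = 0 and xs = "[k, list_encode xs]"])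
      (simp_all add: eval_rules_def asg_def)
next
  case (eval_Succ x)
  show ?case
    by (rule r_into_rtrancl, rule rewr_eval_rulesI[where n = 1 and xs = "[k, x]"])
      (simp_all add: eval_rules_def asg_def)
next
  case (eval_Proj i xs)
  then show ?case
  proof (induction xs arbitrary: i)
    case Nil
    then show ?case by simp
  next
    case (Cons x xs)
    show ?case
    proof (cases i)
      case 0
      show ?thesis unfolding 0
        by (rule r_into_rtrancl,
            rule rewr_eval_rulesI[where n = 2 and xs = "[k, x, list_encode xs]"])
          (simp_all add: eval_rules_def asg_def)
    next
      case (Suc j)
      have "(Suc (prod_encode (goal 0 (recf_code (Proj i)) (list_encode (x # xs)) ((x # xs) ! i), k)),
          Suc (prod_encode (goal 0 (recf_code (Proj j)) (list_encode xs) (xs ! j), k)))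
        \<in> rewr eval_rules"
        unfolding Suc
        by (rule rewr_eval_rulesI[where n = 3 and xs = "[k, j, x, list_encode xs, xs ! j]"])
          (simp_all add: eval_rules_def asg_def)
      from converse_rtrancl_into_rtrancl[OF this Cons.IH] Cons.prems Suc
      show ?thesis by simp
    qed
  qed
next
  case (eval_Comp xs gs ys f z)
  from eval_Comp.IH(1)
  have all: "(Suc (prod_encode (goal 1 (list_encode (map recf_code gs)) (list_encode xs)
      (list_encode ys), k)), k) \<in> (rewr eval_rules)\<^sup>*" for k
  proof (induction arbitrary: k rule: list_all2_induct)
    case Nil
    show ?case
      by (rule r_into_rtrancl,
          rule rewr_eval_rulesI[where n = 5 and xs = "[k, list_encode xs]"])
        (simp_all add: eval_rules_def asg_def)
  next
    case (Cons g gs y ys)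
    have "(Suc (prod_encode (goal 1 (list_encode (map recf_code (g # gs))) (list_encode xs)
        (list_encode (y # ys)), k)),
      Suc (prod_encode (goal 0 (recf_code g) (list_encode xs) y,
        Suc (prod_encode (goal 1 (list_encode (map recf_code gs)) (list_encode xs)
          (list_encode ys), k))))) \<in> rewr eval_rules"
      by (rule rewr_eval_rulesI[where n = 6 and xs = "[k, recf_code g,
          list_encode (map recf_code gs), list_encode xs, y, list_encode ys]"])
        (simp_all add: eval_rules_def asg_def)
    from converse_rtrancl_into_rtrancl[OF this rtrancl_trans[OF Cons.hyps(1)[THEN conjunct2, rule_format] Cons.IH]]
    show ?case .
  qed
  have "(Suc (prod_encode (goal 0 (recf_code (Comp f gs)) (list_encode xs) z, k)),
      Suc (prod_encode (goal 1 (list_encode (map recf_code gs)) (list_encode xs) (list_encode ys),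
        Suc (prod_encode (goal 0 (recf_code f) (list_encode ys) z, k))))) \<in> rewr eval_rules"
    by (rule rewr_eval_rulesI[where n = 4 and xs = "[k, recf_code f,
        list_encode (map recf_code gs), list_encode xs, z, list_encode ys]"])
      (simp_all add: eval_rules_def asg_def)
  from converse_rtrancl_into_rtrancl[OF this rtrancl_trans[OF all eval_Comp.IH(2)]]
  show ?case .
next
  case (eval_PrimRec_0 f xs y g)
  have "(Suc (prod_encode (goal 0 (recf_code (PrimRec f g)) (list_encode (0 # xs)) y, k)),
      Suc (prod_encode (goal 0 (recf_code f) (list_encode xs) y, k))) \<in> rewr eval_rules"
    by (rule rewr_eval_rulesI[where n = 7 and xs = "[k, recf_code f, recf_code g,
        list_encode xs, y]"])
      (simp_all add: eval_rules_def asg_def)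
  from converse_rtrancl_into_rtrancl[OF this eval_PrimRec_0.IH] show ?case .
next
  case (eval_PrimRec_Suc f g n xs r y)
  have "(Suc (prod_encode (goal 0 (recf_code (PrimRec f g)) (list_encode (Suc n # xs)) y, k)),
      Suc (prod_encode (goal 0 (recf_code (PrimRec f g)) (list_encode (n # xs)) r,
        Suc (prod_encode (goal 0 (recf_code g) (list_encode (n # r # xs)) y, k)))))
      \<in> rewr eval_rules"
    by (rule rewr_eval_rulesI[where n = 8 and xs = "[k, recf_code f, recf_code g,
        list_encode xs, y, n, r]"])
      (simp_all add: eval_rules_def asg_def)
  from converse_rtrancl_into_rtrancl[OF this rtrancl_trans[OF eval_PrimRec_Suc.IH]]
  show ?case .
next
  case (eval_Mu f n xs)
  \<comment> \<open>A goal with tag 2 gives off its largest index in each step, so the values below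
    the bound are treated downwards.\<close>
  have below: "(Suc (prod_encode (goal 2 (recf_code f) (list_encode xs) m, k)), k)
      \<in> (rewr eval_rules)\<^sup>*" if "m \<le> n" for m k
    using that
  proof (induction m arbitrary: k)
    case 0
    show ?case
      by (rule r_into_rtrancl,
          rule rewr_eval_rulesI[where n = 10 and xs = "[k, recf_code f, list_encode xs]"])
        (simp_all add: eval_rules_def asg_def)
  next
    case (Suc m)
    from eval_Mu.IH(2)[of m] Suc.prems obtain y where
      y: "\<And>k. (Suc (prod_encode (goal 0 (recf_code f) (list_encode (m # xs)) (Suc y), k)), k)
        \<in> (rewr eval_rules)\<^sup>*"
      by auto
    have "(Suc (prod_encode (goal 2 (recf_code f) (list_encode xs) (Suc m), k)),
        Suc (prod_encode (goal 0 (recf_code f) (list_encode (m # xs)) (Suc y),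
          Suc (prod_encode (goal 2 (recf_code f) (list_encode xs) m, k)))))
        \<in> rewr eval_rules"
      by (rule rewr_eval_rulesI[where n = 11 and xs = "[k, recf_code f, list_encode xs, m, y]"])
        (simp_all add: eval_rules_def asg_def)
    from converse_rtrancl_into_rtrancl[OF this rtrancl_trans[OF y Suc.IH]] Suc.prems
    show ?case by simp
  qed
  have "(Suc (prod_encode (goal 0 (recf_code (Mu f)) (list_encode xs) n, k)),
      Suc (prod_encode (goal 0 (recf_code f) (list_encode (n # xs)) 0,
        Suc (prod_encode (goal 2 (recf_code f) (list_encode xs) n, k)))))
      \<in> rewr eval_rules"
    by (rule rewr_eval_rulesI[where n = 9 and xs = "[k, recf_code f, list_encode xs, n]"])
      (simp_all add: eval_rules_def asg_def)
  from converse_rtrancl_into_rtrancl[OF this rtrancl_trans[OF eval_Mu.IH(1) below[OF order_refl]]]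
  show ?case .
qed

text \<open>A substitution may put any number into a program position, so a goal with an invalid
  program code counts as true. Truth can then be carried backwards from the empty list along every
  step.\<close>

definition holds :: "nat \<Rightarrow> bool" where
  "holds a \<longleftrightarrow>
    (\<forall>f xs y. a = goal 0 (recf_code f) (list_encode xs) y \<longrightarrow> eval f xs y) \<and>
    (\<forall>gs xs ys. a = goal 1 (list_encode (map recf_code gs)) (list_encode xs) (list_encode ys) \<longrightarrow>
      list_all2 (\<lambda>g y. eval g xs y) gs ys) \<and>
    (\<forall>f xs n. a = goal 2 (recf_code f) (list_encode xs) n \<longrightarrow>
      (\<forall>i<n. \<exists>y. eval f (i # xs) (Suc y)))"

text \<open>List coding is onto, so argument and result positions always are codes, and only the
  program positions of \<open>holds\<close> stay conditional.\<close>

lemma eq_list_encode_iff: "d = list_encode xs \<longleftrightarrow> xs = list_decode d"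
  by auto

lemma holds_goal_0:
  "holds (goal 0 c d y) \<longleftrightarrow> (\<forall>f. c = recf_code f \<longrightarrow> eval f (list_decode d) y)"
  by (simp add: holds_def eq_list_encode_iff)

lemma holds_goal_1:
  "holds (goal 1 c d e) \<longleftrightarrow> (\<forall>gs. c = list_encode (map recf_code gs) \<longrightarrow>
    list_all2 (\<lambda>g y. eval g (list_decode d) y) gs (list_decode e))"
  by (simp add: holds_def eq_list_encode_iff)

lemma holds_goal_2:
  "holds (goal 2 c d n) \<longleftrightarrow> (\<forall>f. c = recf_code f \<longrightarrow>
    (\<forall>i<n. \<exists>y. eval f (i # list_decode d) (Suc y)))"
  by (simp add: holds_def eq_list_encode_iff)

lemmas holds_goal = holds_goal_0 holds_goal_1[unfolded One_nat_def] holds_goal_2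

lemma recf_code_inject [simp]: "recf_code f = recf_code g \<longleftrightarrow> f = g"
proof
  show "recf_code f = recf_code g \<Longrightarrow> f = g"
  proof (induction f arbitrary: g)
    case (Comp f fs)
    from Comp.prems obtain g' gs where g: "g = Comp g' gs" "recf_code f = recf_code g'"
      "map recf_code fs = map recf_code gs"
      by (cases g) (auto simp: list_encode_eq)
    have "fs = gs"
      by (rule list.inj_map_strong[OF _ g(3)]) (rule Comp.IH(2))
    with g Comp.IH(1) show ?case by simp
  next
    case (PrimRec f f')
    then show ?case by (cases g) auto
  next
    case (Mu f)
    then show ?case by (cases g) auto
  qed (case_tac g; simp)+
qed simp

lemma list_encode_recf_code_inject [simp]:
  "list_encode (map recf_code fs) = list_encode (map recf_code gs) \<longleftrightarrow> fs = gs"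
  by (simp add: list_encode_eq inj_map_eq_map inj_def)

lemma prod_encode_eq_recf_code:
  "prod_encode (0, n) = recf_code f \<longleftrightarrow> n = 0 \<and> f = Zero"
  "prod_encode (Suc 0, n) = recf_code f \<longleftrightarrow> n = 0 \<and> f = Succ"
  "prod_encode (2, n) = recf_code f \<longleftrightarrow> f = Proj n"
  "prod_encode (3, prod_encode (c, d)) = recf_code f \<longleftrightarrow>
    (\<exists>g hs. f = Comp g hs \<and> c = recf_code g \<and> d = list_encode (map recf_code hs))"
  "prod_encode (4, prod_encode (c, d)) = recf_code f \<longleftrightarrow>
    (\<exists>g h. f = PrimRec g h \<and> c = recf_code g \<and> d = recf_code h)"
  "prod_encode (5, c) = recf_code f \<longleftrightarrow> (\<exists>g. f = Mu g \<and> c = recf_code g)"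
  by (cases f; auto)+

lemma list_encode_map_eq:
  "0 = list_encode (map f xs) \<longleftrightarrow> xs = []"
  "Suc (prod_encode (a, b)) = list_encode (map f xs) \<longleftrightarrow>
    (\<exists>y ys. xs = y # ys \<and> a = f y \<and> b = list_encode (map f ys))"
  by (cases xs; auto)+

lemma eval_Proj_iff: "eval (Proj i) xs y \<longleftrightarrow> i < length xs \<and> y = xs ! i"
proof
  assume "eval (Proj i) xs y"
  then show "i < length xs \<and> y = xs ! i" by cases simp
qed (auto intro: eval_Proj)

text \<open>Each rule reads a clause from conclusion to premises, so true premises give a true goal.
  The two projection rules unfold an index one list entry at a time; the rules for tags 1 and 2
  unfold \<open>list_all2\<close> and the bounded quantifier.\<close>

lemma rewr_eval_rules_sound:
  assumes "(a, b) \<in> rewr eval_rules" "\<forall>g\<in>set (list_decode b). holds g"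
  shows "\<forall>g\<in>set (list_decode a). holds g"
proof -
  have "list_all (\<lambda>(l, r). (\<forall>g\<in>set (list_decode (val \<rho> r)). holds g) \<longrightarrow>
    (\<forall>g\<in>set (list_decode (val \<rho> l)). holds g)) eval_rules" for \<rho>
    by (auto simp: eval_rules_def holds_goal less_Suc_eq prod_encode_eq_recf_code
        list_encode_map_eq eval_Proj_iff eval_Zero eval_Succ
        intro: eval_Comp eval_PrimRec_0 eval_PrimRec_Suc eval_Mu)
  with assms show ?thesis
    unfolding rewr_def list_all_iff by fast
qed

theorem eval_iff_rewr:
  "eval f xs y \<longleftrightarrow>
    (Suc (prod_encode (goal 0 (recf_code f) (list_encode xs) y, 0)), 0) \<in> (rewr eval_rules)\<^sup>*"
    (is "_ \<longleftrightarrow> (?a, 0) \<in> _")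
proof
  assume "(?a, 0) \<in> (rewr eval_rules)\<^sup>*"
  then have "\<forall>g\<in>set (list_decode ?a). holds g"
    by (induction rule: converse_rtrancl_induct) (auto dest: rewr_eval_rules_sound)
  then show "eval f xs y"
    by (simp add: holds_goal)
qed (rule eval_rules_complete)

text \<open>Needed to exclude that the diagonal program yields both 0 and 1 on its own code. For
  \<open>Mu\<close>, two different results would make the body both zero and positive at the smaller
  one.\<close>

lemma eval_functional: "eval f xs y \<Longrightarrow> eval f xs z \<Longrightarrow> y = z"
proof (induction arbitrary: z rule: eval.induct)
  case (eval_Comp xs gs ys f z)
  note IH = eval_Comp.IH
  from eval_Comp.prems show ?case
  proof cases
    case (eval_Comp ys')
    have "ys = ys'"
      using IH(1) eval_Comp(1)
      by (induction arbitrary: ys' rule: list_all2_induct) (auto simp: list_all2_Cons1)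
    with eval_Comp(2) IH(2) show ?thesis by simp
  qed
next
  case (eval_PrimRec_Suc f g n xs r y)
  note IH = eval_PrimRec_Suc.IH
  from eval_PrimRec_Suc.prems show ?case
  proof cases
    case (eval_PrimRec_Suc r')
    with IH show ?thesis by metis
  qed
next
  case (eval_Mu f n xs)
  note IH = eval_Mu.IH
  from eval_Mu.prems show ?case
  proof cases
    case eval_Mu
    show ?thesis
    proof (cases n z rule: linorder_cases)
      case less
      with eval_Mu(2) IH(1) show ?thesis by fastforce
    next
      case greater
      with eval_Mu(1) IH(2) show ?thesis by fastforce
    qed
  qed
next
  case eval_Zero
  then show ?case by cases simp
next
  case eval_Succ
  then show ?case by cases simp
next
  case eval_Proj
  then show ?case by (simp add: eval_Proj_iff)
next
  case (eval_PrimRec_0 f xs y g)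
  from eval_PrimRec_0.prems show ?case by cases (rule eval_PrimRec_0.IH)
qed

section \<open>Computable functions\<close>

text \<open>The map \<open>args\<close> from parameters to argument lists lets one notion serve all
  arities, with tuples as parameters.\<close>

definition computable :: "('p \<Rightarrow> nat list) \<Rightarrow> ('p \<Rightarrow> nat) \<Rightarrow> bool" where
  "computable args f \<longleftrightarrow> (\<exists>r. \<forall>p. eval r (args p) (f p))"

lemma computable_Proj:
  assumes "\<And>p. i < length (args p)" "\<And>p. f p = args p ! i"
  shows "computable args f"
  unfolding computable_def using assms by (metis eval_Proj)

lemma computable_comp:
  assumes "\<forall>p. eval r (map (\<lambda>g. g p) gs) (f p)" "\<forall>g\<in>set gs. computable args g"
  shows "computable args f"
proof -
  from assms(2) obtain R where R: "\<And>g p. g \<in> set gs \<Longrightarrow> eval (R g) (args p) (g p)"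
    unfolding computable_def by metis
  have "eval (Comp r (map R gs)) (args p) (f p)" for p
    using assms(1) R by (auto intro!: eval_Comp[where ys = "map (\<lambda>g. g p) gs"] list_all2_all_nthI)
  then show ?thesis
    unfolding computable_def by blast
qed

lemma computable_comp2:
  assumes "computable (\<lambda>(x, y). [x, y]) (\<lambda>(x, y). F x y)" "computable args g" "computable args h"
  shows "computable args (\<lambda>p. F (g p) (h p))"
proof -
  from assms(1) obtain r where "\<And>x y. eval r [x, y] (F x y)"
    unfolding computable_def by auto
  then show ?thesis
    using assms(2,3) by (intro computable_comp[where r = r and gs = "[g, h]"]) auto
qed

lemma computable_comp1:
  assumes "computable (\<lambda>x. [x]) F" "computable args g"
  shows "computable args (\<lambda>p. F (g p))"
proof -
  from assms(1) obtain r where "\<And>x. eval r [x] (F x)"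
    unfolding computable_def by auto
  then show ?thesis
    using assms(2) by (intro computable_comp[where r = r and gs = "[g]"]) auto
qed

lemma computable_rec:
  assumes "computable args f" "computable (\<lambda>(n, r, p). n # r # args p) g"
    "\<And>p. F 0 p = f p" "\<And>n p. F (Suc n) p = g (n, F n p, p)"
  shows "computable (\<lambda>(n, p). n # args p) (\<lambda>(n, p). F n p)"
proof -
  from assms(1,2) obtain r s where r: "\<And>p. eval r (args p) (f p)"
    and s: "\<And>n q p. eval s (n # q # args p) (g (n, q, p))"
    unfolding computable_def by auto
  have "eval (PrimRec r s) (n # args p) (F n p)" for n p
    by (induction n) (auto simp: assms(3,4) intro: eval_PrimRec_0 eval_PrimRec_Suc r s)
  then show ?thesis
    unfolding computable_def by auto
qed

lemma computable_rec1:
  assumes "computable (\<lambda>(n, r). [n, r]) (\<lambda>(n, r). g n r)" "\<And>n. F (Suc n) = g n (F n)" "F 0 = 0"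
  shows "computable (\<lambda>x. [x]) F"
proof -
  \<comment> \<open>The parameter type \<open>unit\<close> stands for an empty list of
    parameters.\<close>
  have "computable (\<lambda>_ :: unit. []) (\<lambda>_. 0)"
    unfolding computable_def by (blast intro: eval_Zero)
  moreover from assms(1) have "computable (\<lambda>(n, r, _ :: unit). [n, r]) (\<lambda>(n, r, _). g n r)"
    unfolding computable_def by auto
  ultimately have "computable (\<lambda>(n, _ :: unit). [n]) (\<lambda>(n, _). F n)"
    using assms(2,3) by (intro computable_rec[where F = "\<lambda>n _. F n"]) auto
  then show ?thesis
    unfolding computable_def by auto
qed

lemma computable_id: "computable (\<lambda>x. [x]) (\<lambda>x. x)"
  by (rule computable_Proj[where i = 0]) auto

lemma computable_fst: "computable (\<lambda>(x, y). [x, y]) (\<lambda>(x, y). x)"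
  by (rule computable_Proj[where i = 0]) auto

lemma computable_snd: "computable (\<lambda>(x, y). [x, y]) (\<lambda>(x, y). y)"
  by (rule computable_Proj[where i = 1]) auto

lemma computable_Suc:
  assumes "computable args f" shows "computable args (\<lambda>p. Suc (f p))"
proof -
  have "computable (\<lambda>x. [x]) Suc"
    unfolding computable_def by (blast intro: eval_Succ)
  from computable_comp1[OF this assms] show ?thesis .
qed

lemma computable_const: "computable args (\<lambda>_. n)"
proof (induction n)
  case 0
  show ?case unfolding computable_def by (blast intro: eval_Zero)
qed (rule computable_Suc)

lemma computable_add:
  assumes "computable args f" "computable args g"
  shows "computable args (\<lambda>p. f p + g p)"
proof -
  have "computable (\<lambda>(n, p). n # [p]) (\<lambda>(n, p). n + p)"
    by (rule computable_rec[where F = "(+)" and g = "\<lambda>(n, r, p). Suc r", OF computable_id])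
      (auto simp: case_prod_unfold intro!: computable_Suc computable_Proj[where i = 1])
  from computable_comp2[OF this assms] show ?thesis .
qed

lemma computable_pred:
  assumes "computable args f" shows "computable args (\<lambda>p. f p - 1)"
proof -
  have "computable (\<lambda>x. [x]) (\<lambda>n. n - 1)"
    by (rule computable_rec1[OF computable_fst]) auto
  from computable_comp1[OF this assms] show ?thesis .
qed

lemma computable_diff:
  assumes "computable args f" "computable args g"
  shows "computable args (\<lambda>p. f p - g p)"
proof -
  have "computable (\<lambda>(n, p). n # [p]) (\<lambda>(n, p). p - n)"
    by (rule computable_rec[where F = "\<lambda>n p. p - n" and g = "\<lambda>(n, r, p). r - 1", OF computable_id])
      (auto simp: case_prod_unfold intro!: computable_pred[unfolded One_nat_def]
        computable_Proj[where i = 1])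
  from computable_comp2[OF this assms(2,1)] show ?thesis .
qed

text \<open>Branching is primitive recursion whose step ignores the previous value. The sum of both
  truncated differences vanishes exactly on equality and serves as the recursion argument.\<close>

lemma computable_if_eq:
  assumes "computable args f" "computable args g" "computable args h" "computable args k"
  shows "computable args (\<lambda>p. if f p = g p then h p else k p)"
proof -
  have "computable (\<lambda>(n, p). n # (\<lambda>(x, y). [x, y]) p)
      (\<lambda>(n, p). if n = 0 then fst p else snd p)"
  proof (rule computable_rec)
    show "computable (\<lambda>(x, y). [x, y]) fst"
      by (rule computable_Proj[where i = 0]) auto
    show "computable (\<lambda>(n, r, p). n # r # (\<lambda>(x, y). [x, y]) p) (\<lambda>(n, r, p). snd p)"
      by (rule computable_Proj[where i = 3]) auto
  qed auto
  then obtain r where r: "\<And>n x y. eval r [n, x, y] (if n = 0 then x else y)"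
    unfolding computable_def by (auto cong: if_cong)
  have "f p - g p + (g p - f p) = 0 \<longleftrightarrow> f p = g p" for p
    by linarith
  then have "eval r [f p - g p + (g p - f p), h p, k p] (if f p = g p then h p else k p)" for p
    using r[of "f p - g p + (g p - f p)" "h p" "k p"] by (simp only:)
  then show ?thesis
    using assms by (intro computable_comp
        [where r = r and gs = "[\<lambda>p. f p - g p + (g p - f p), h, k]"])
      (simp_all add: computable_add computable_diff)
qed

lemma computable_triangle:
  assumes "computable args f" shows "computable args (\<lambda>p. triangle (f p))"
proof -
  have "computable (\<lambda>x. [x]) triangle"
  proof (rule computable_rec1)
    show "computable (\<lambda>(n, r). [n, r]) (\<lambda>(n, r). r + Suc n)"
      using computable_fst computable_snd unfolding case_prod_unfold
      by (intro computable_add computable_Suc)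
  qed (rule triangle_Suc triangle_0)+
  from computable_comp1[OF this assms] show ?thesis .
qed

lemma computable_prod_encode:
  assumes "computable args f" "computable args g"
  shows "computable args (\<lambda>p. prod_encode (f p, g p))"
  unfolding prod_encode_def prod.case
  by (intro computable_add computable_triangle assms)

text \<open>\<open>prod_encode\<close> runs through the antidiagonals with increasing first
  component; from \<open>(m, 0)\<close> it passes to the start of the next one. The counters later
  make the same walk.\<close>

lemma prod_decode_Suc:
  "prod_decode (Suc z) =
    (case prod_decode z of (m, n) \<Rightarrow> if n = 0 then (0, Suc m) else (Suc m, n - 1))"
proof -
  obtain m n where mn: "prod_decode z = (m, n)" by force
  then have z: "z = prod_encode (m, n)" using prod_decode_inverse[of z] by simp
  have "Suc z = prod_encode (if n = 0 then (0, Suc m) else (Suc m, n - 1))"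
    unfolding z by (cases n) (auto simp: prod_encode_def)
  then show ?thesis
    using mn by simp
qed

text \<open>Primitive recursion carries a single number, so the decoded pair is not computed
  directly. Its antidiagonal is: it grows exactly when the next triangular number is reached, and it
  determines both components.\<close>

definition diagonal :: "nat \<Rightarrow> nat" where
  "diagonal z = fst (prod_decode z) + snd (prod_decode z)"

lemma diagonal_0: "diagonal 0 = 0"
  using prod_encode_inverse[of "(0, 0)"] by (simp add: diagonal_def prod_encode_def)

lemma diagonal_Suc:
  "diagonal (Suc z) = (if Suc z = triangle (Suc (diagonal z)) then Suc (diagonal z) else diagonal z)"
proof -
  obtain m n where mn: "prod_decode z = (m, n)" by force
  then have "z = prod_encode (m, n)" using prod_decode_inverse[of z] by simp
  then show ?thesis
    using mn by (auto simp: diagonal_def prod_decode_Suc prod_encode_def)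
qed

lemma computable_diagonal:
  assumes "computable args f" shows "computable args (\<lambda>p. diagonal (f p))"
proof -
  have "computable (\<lambda>x. [x]) diagonal"
  proof (rule computable_rec1)
    show "computable (\<lambda>(n, r). [n, r])
        (\<lambda>(n, r). if Suc n = triangle (Suc r) then Suc r else r)"
      using computable_fst computable_snd unfolding case_prod_unfold
      by (intro computable_if_eq computable_triangle computable_Suc)
  qed (rule diagonal_Suc diagonal_0)+
  from computable_comp1[OF this assms] show ?thesis .
qed

lemma computable_prod_decode:
  assumes "computable args f"
  shows "computable args (\<lambda>p. fst (prod_decode (f p)))"
    and "computable args (\<lambda>p. snd (prod_decode (f p)))"
proof -
  have eq: "z = triangle (diagonal z) + fst (prod_decode z)" for z
  proof -
    obtain m n where mn: "prod_decode z = (m, n)" by force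
    then have "z = prod_encode (m, n)" using prod_decode_inverse[of z] by simp
    then show ?thesis using mn by (simp add: diagonal_def prod_encode_def)
  qed
  have 1: "fst (prod_decode z) = z - triangle (diagonal z)" for z
    using eq[of z] by linarith
  have 2: "snd (prod_decode z) = diagonal z - (z - triangle (diagonal z))" for z
    using 1[of z] by (simp add: diagonal_def)
  show "computable args (\<lambda>p. fst (prod_decode (f p)))"
    unfolding 1 by (intro computable_diff computable_triangle computable_diagonal assms)
  show "computable args (\<lambda>p. snd (prod_decode (f p)))"
    unfolding 2 by (intro computable_diff computable_triangle computable_diagonal assms)
qed

lemma computable_list_encode:
  assumes "\<And>x. x \<in> set xs \<Longrightarrow> computable args (\<lambda>p. f p x)"
  shows "computable args (\<lambda>p. list_encode (map (f p) xs))"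
  using assms
  by (induction xs) (auto intro!: computable_const computable_Suc computable_prod_encode)

lemma computable_val:
  assumes "\<And>i. i \<in> vars t \<Longrightarrow> computable args (\<lambda>p. \<rho> p i)"
  shows "computable args (\<lambda>p. val (\<rho> p) t)"
  using assms
  by (induction t) (auto intro!: computable_const computable_Suc computable_prod_encode)

section \<open>A diagonal argument\<close>

text \<open>With value \<open>e\<close> for variable 0 this is the list whose only goal asks that
  the program coded by \<open>e\<close> yields 0 on \<open>e\<close>.\<close>

definition self_goal :: pat where
  "self_goal = pcons (pgoal 0 (PVar 0) (pcons (PVar 0) PZero) PZero) PZero"

lemma self_goal_rewr:
  "(val (\<lambda>_. recf_code f) self_goal, 0) \<in> (rewr eval_rules)\<^sup>* \<longleftrightarrow> eval f [recf_code f] 0"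
  by (simp add: self_goal_def eval_iff_rewr)

text \<open>The pattern \<open>t\<close> turns \<open>a\<close> into the code of a start state, so
  composing \<open>D\<close> with pattern evaluation gives a one-argument program \<open>E\<close>.
  On the code of a program it yields 1 if that program yields 0 on its own code, and 0 otherwise.
  Applied to the code of \<open>E\<close> this is contradictory.\<close>

lemma undecidable_rewr:
  assumes "\<And>a. eval D [c, val (\<lambda>_. a) t, y]
    (if (a, 0) \<in> (rewr eval_rules)\<^sup>* then 1 else 0)"
  shows False
proof -
  define s where "s e = val (\<lambda>_ :: nat. e) self_goal" for e
  have cv: "computable args (\<lambda>p. val (\<lambda>_. f p) u)" if "computable args f"
    for u f and args :: "nat \<Rightarrow> nat list"
    by (rule computable_val) (rule that)
  have "computable (\<lambda>e. [e]) (\<lambda>e. if (s e, 0) \<in> (rewr eval_rules)\<^sup>* then 1 else 0)"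
  proof (rule computable_comp[where r = D and gs = "[\<lambda>_. c, \<lambda>e. val (\<lambda>_. s e) t, \<lambda>_. y]"])
    have "computable (\<lambda>e. [e]) s"
      unfolding s_def by (intro cv computable_id)
    then have "computable (\<lambda>e. [e]) (\<lambda>e. val (\<lambda>_. s e) t)"
      by (rule cv)
    then show "\<forall>g\<in>set [\<lambda>_. c, \<lambda>e. val (\<lambda>_. s e) t, \<lambda>_. y]. computable (\<lambda>e. [e]) g"
      by (simp add: computable_const)
  qed (simp add: assms)
  then obtain E where E: "\<And>e. eval E [e] (if (s e, 0) \<in> (rewr eval_rules)\<^sup>* then 1 else 0)"
    unfolding computable_def by blast
  from E[of "recf_code E"] self_goal_rewr[of E]
    eval_functional[of E "[recf_code E]" 0 1] show False
    by (simp add: s_def split: if_splits)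
qed

section \<open>Rewriting systems presented by programs\<close>

text \<open>Iterated unpairing reads any single number as a total substitution. Prescribed values
  can be met on every finite initial segment, which covers the variables of a rule.\<close>

primrec digit :: "nat \<Rightarrow> nat \<Rightarrow> nat" where
  "digit g 0 = fst (prod_decode g)"
| "digit g (Suc i) = digit (snd (prod_decode g)) i"

lemma ex_digits: "\<exists>g. \<forall>i<n. digit g i = \<rho> i"
proof (induction n arbitrary: \<rho>)
  case (Suc n)
  from Suc[of "\<lambda>i. \<rho> (Suc i)"] obtain g where "\<forall>i<n. digit g i = \<rho> (Suc i)"
    by blast
  then have "\<forall>i<Suc n. digit (prod_encode (\<rho> 0, g)) i = \<rho> i"
    by (auto simp: less_Suc_eq_0_disj)
  then show ?case ..
qed simp

lemma computable_digit: "computable args f \<Longrightarrow> computable args (\<lambda>p. digit (f p) i)"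
proof (induction i arbitrary: f)
  case 0
  then show ?case by (simp add: computable_prod_decode(1))
next
  case (Suc i)
  from Suc.IH[OF computable_prod_decode(2)[OF Suc.prems]] show ?case by simp
qed

text \<open>
  To stay finitely branching, a state \<open>prod_encode (a, g)\<close> may increase the guess \<open>g\<close>, or use it
  as a substitution that rewrites \<open>a\<close>.
\<close>

definition grow :: "nat \<Rightarrow> nat" where
  "grow x = (if x = 0 then 0
    else prod_encode (fst (prod_decode x), Suc (snd (prod_decode x))))"

text \<open>A rule that does not match leaves the state fixed, so \<open>fire\<close> is total and
  the successors are the values of a fixed list of functions. Resetting the guess to 0 makes the
  rewritten number 0 give the state \<open>0\<close>.\<close>

definition fire :: "pat \<times> pat \<Rightarrow> nat \<Rightarrow> nat" where
  "fire p x = (if x = 0 then 0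
    else if val (digit (snd (prod_decode x))) (fst p) = fst (prod_decode x)
    then prod_encode (val (digit (snd (prod_decode x))) (snd p), 0) else x)"

text \<open>The order has two classes, \<open>0\<close> and everything else: few enough for a
  well-quasi-order, and nothing but \<open>0\<close> lies below the initial state.\<close>

definition rewr_lts :: "(pat \<times> pat) list \<Rightarrow> (nat, nat) lts" where
  "rewr_lts R =
    \<lparr>states = UNIV, alphabet = {0},
     transitions = {(x, a, y). a = 0 \<and> y \<in> (\<lambda>h. h x) ` set (grow # map fire R)},
     leq = (\<lambda>x y. x = 0 \<longleftrightarrow> y = 0), init = 0\<rparr>"

lemma computable_grow: "computable (\<lambda>x. [x]) grow"
  unfolding grow_def
  by (intro computable_if_eq computable_const computable_prod_encode computable_prod_decode
      computable_Suc computable_id)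

lemma computable_fire: "computable (\<lambda>x. [x]) (fire p)"
  unfolding fire_def
  by (intro computable_if_eq computable_const computable_prod_encode computable_prod_decode
      computable_val computable_digit computable_id)

lemma step_rel_rewr_lts:
  "(x, y) \<in> step_rel (rewr_lts R) \<longleftrightarrow> y = grow x \<or> (\<exists>p\<in>set R. y = fire p x)"
  by (auto simp: step_rel_def rewr_lts_def)

lemma program_presents_rewr_lts: "\<exists>c. program_presents c (rewr_lts R)"
proof -
  have "computable (\<lambda>x :: nat. [x]) (\<lambda>_. 1)"
    by (rule computable_const)
  then obtain m where m: "\<And>x :: nat. eval m [x] 1"
    unfolding computable_def by blast
  have "computable (\<lambda>(x, y). [x, y])
      (\<lambda>(x, y). if x = 0 then if y = 0 then 1 else 0 else if y = 0 then 0 else 1 :: nat)"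
    using computable_fst computable_snd unfolding case_prod_unfold
    by (intro computable_if_eq computable_const)
  then obtain l where l: "\<And>x y :: nat. eval l [x, y]
      (if x = 0 then if y = 0 then 1 else 0 else if y = 0 then 0 else 1)"
    unfolding computable_def by auto
  have "computable (\<lambda>x. [x])
      (\<lambda>x. list_encode (map (\<lambda>h. prod_encode (0, h x)) (grow # map fire R)))"
    by (rule computable_list_encode, rule computable_prod_encode)
      (auto intro: computable_const computable_grow computable_fire)
  then obtain t where t: "\<And>x. eval t [x]
      (list_encode (map (\<lambda>h. prod_encode (0, h x)) (grow # map fire R)))"
    unfolding computable_def by blast
  have "\<exists>ts. eval t [x] (list_encode (map prod_encode ts)) \<and>
      set ts = {(a, y). (x, a, y) \<in> transitions (rewr_lts R)}" for x
  proof (intro exI conjI)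
    show "eval t [x] (list_encode (map prod_encode (map (\<lambda>h. (0, h x)) (grow # map fire R))))"
      using t[of x] by (simp add: comp_def)
  qed (auto simp: rewr_lts_def)
  moreover have "eval l [x, y] (if leq (rewr_lts R) x y then 1 else 0)" for x y
    using l[of x y] by (simp add: rewr_lts_def split: if_splits)
  ultimately show ?thesis
    unfolding program_presents_def using m
    by (intro exI[of _ "list_encode [recf_code m, recf_code l, recf_code t, list_encode [0],
        init (rewr_lts R)]"] exI[of _ m] exI[of _ l] exI[of _ t] exI[of _ "[0]"])
      (simp add: rewr_lts_def)
qed

lemma Post_star_rewr_lts_0: "Post_star (rewr_lts R) 0 = {0}"
proof -
  have "y = 0" if "(0, y) \<in> (step_rel (rewr_lts R))\<^sup>*" for y
    using that by induction (auto simp: step_rel_rewr_lts grow_def fire_def)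
  then show ?thesis
    by (auto simp: Post_star_def)
qed

lemma cover_WSTS_rewr_lts: "cover_WSTS (rewr_lts R)"
proof -
  have "finite {y. (x, y) \<in> step_rel (rewr_lts R)}" for x
  proof (rule finite_subset)
    show "{y. (x, y) \<in> step_rel (rewr_lts R)} \<subseteq> insert (grow x) ((\<lambda>p. fire p x) ` set R)"
      by (auto simp: step_rel_rewr_lts)
  qed simp
  then have "finitely_branching (rewr_lts R)"
    by (simp add: finitely_branching_def)
  moreover have "quasi_order_on UNIV (leq (rewr_lts R))"
    by (auto simp: quasi_order_on_def rewr_lts_def intro!: reflp_onI transp_onI)
  moreover have "\<exists>i j. i < j \<and> (s i = 0 \<longleftrightarrow> s j = 0)" for s :: "nat \<Rightarrow> nat"
  proof -
    have "(s 0 = 0 \<longleftrightarrow> s 1 = 0) \<or> (s 0 = 0 \<longleftrightarrow> s 2 = 0) \<or> (s 1 = 0 \<longleftrightarrow> s 2 = 0)"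
      by blast
    moreover have "0 < (1 :: nat)" "0 < (2 :: nat)" "1 < (2 :: nat)"
      by simp_all
    ultimately show ?thesis by blast
  qed
  moreover have "cover_monotone (rewr_lts R)"
    unfolding cover_monotone_def
    by (auto simp: down_def rewr_lts_def[of R, THEN arg_cong[where f = init]]
        rewr_lts_def[of R, THEN arg_cong[where f = leq]] Post_star_rewr_lts_0
        step_rel_rewr_lts grow_def fire_def)
  ultimately show ?thesis
    by (auto simp: cover_WSTS_def ordered_lts_def wqo_on_def rewr_lts_def)
qed

text \<open>The first component changes only by rewriting, whatever the guess does. Conversely, a
  rewriting step is imitated by counting the guess up to a code of its substitution and
  firing.\<close>

lemma rewr_lts_reach:
  "(prod_encode (a, 0), 0) \<in> (step_rel (rewr_lts R))\<^sup>* \<longleftrightarrow> (a, 0) \<in> (rewr R)\<^sup>*"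
proof
  let ?S = "step_rel (rewr_lts R)"
  have fst0: "fst (prod_decode 0) = 0"
    using prod_encode_inverse[of "(0, 0)"] by (simp add: prod_encode_def)
  have "(fst (prod_decode x), 0) \<in> (rewr R)\<^sup>*" if "(x, 0) \<in> ?S\<^sup>*" for x
    using that
  proof (induction rule: converse_rtrancl_induct)
    case (step x y)
    have "fst (prod_decode y) = fst (prod_decode x) \<or>
      (fst (prod_decode x), fst (prod_decode y)) \<in> rewr R"
      using step.hyps(1) unfolding step_rel_rewr_lts
    proof (elim disjE bexE)
      fix p assume p: "p \<in> set R" "y = fire p x"
      show ?thesis
      proof (cases "x \<noteq> 0 \<and> val (digit (snd (prod_decode x))) (fst p) = fst (prod_decode x)")
        case True
        then have "(fst (prod_decode x), fst (prod_decode y)) =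
            (val (digit (snd (prod_decode x))) (fst p), val (digit (snd (prod_decode x))) (snd p))"
          using p by (simp add: fire_def)
        with p(1) show ?thesis
          unfolding rewr_def by (metis (mono_tags, lifting) mem_Collect_eq prod.collapse)
      next
        case False
        then show ?thesis using p by (auto simp: fire_def)
      qed
    qed (simp add: grow_def)
    with step.IH show ?case
      by (metis converse_rtrancl_into_rtrancl)
  qed (simp add: fst0)
  from this[of "prod_encode (a, 0)"] show "(a, 0) \<in> (rewr R)\<^sup>*"
    if "(prod_encode (a, 0), 0) \<in> ?S\<^sup>*"
    using that by simp
  show "(prod_encode (a, 0), 0) \<in> ?S\<^sup>*" if "(a, 0) \<in> (rewr R)\<^sup>*"
    using that
  proof (induction rule: converse_rtrancl_induct)
    case base
    show ?case by (simp add: prod_encode_def)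
  next
    case (step a b)
    show ?case
    \<comment> \<open>The pair \<open>(0, 0)\<close> has code 0, so here the start state already is
      the target. It is split off because \<open>grow\<close> does not leave
      \<open>0\<close>.\<close>
    proof (cases "a = 0")
      case True
      then show ?thesis by (simp add: prod_encode_def)
    next
      case False
      then have nz: "prod_encode (a, g) \<noteq> 0" for g
        by (simp add: prod_encode_def)
      from step.hyps(1) obtain \<rho> l r where lr: "(l, r) \<in> set R" "a = val \<rho> l" "b = val \<rho> r"
        by (auto simp: rewr_def)
      have "finite (vars l \<union> vars r)"
        by (simp add: finite_vars)
      then obtain n where n: "\<And>i. i \<in> vars l \<union> vars r \<Longrightarrow> i < n"
        using finite_nat_set_iff_bounded by metis
      obtain g where "\<And>i. i < n \<Longrightarrow> digit g i = \<rho> i"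
        using ex_digits by metis
      with n have val: "val (digit g) l = a" "val (digit g) r = b"
        using lr by (auto intro!: val_cong)
      have "(prod_encode (a, 0), prod_encode (a, h)) \<in> ?S\<^sup>*" for h
      proof (induction h)
        case (Suc h)
        have "(prod_encode (a, h), prod_encode (a, Suc h)) \<in> ?S"
          by (simp add: step_rel_rewr_lts grow_def nz)
        with Suc show ?case by (rule rtrancl_into_rtrancl)
      qed simp
      moreover have "fire (l, r) (prod_encode (a, g)) = prod_encode (b, 0)"
        using val nz[of g] by (simp add: fire_def)
      then have "(prod_encode (a, g), prod_encode (b, 0)) \<in> ?S"
        using lr(1) unfolding step_rel_rewr_lts by metis
      ultimately show ?thesis
        using step.IH by (meson converse_rtrancl_into_rtrancl rtrancl_trans)
    qed
  qed
qed

lemma coverable_rewr_lts: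
  "coverable (rewr_lts R) (prod_encode (a, 0)) 0 \<longleftrightarrow> (a, 0) \<in> (rewr R)\<^sup>*"
  unfolding rewr_lts_reach[symmetric]
  by (auto simp: coverable_def down_def Post_star_def rewr_lts_def[of R, THEN arg_cong[where f = leq]]
      rewr_lts_def[of R, THEN arg_cong[where f = states]])

lemma undecidable_program_presents: "\<not> decides_coverability D (\<lambda>x. x) program_presents"
proof
  assume D: "decides_coverability D (\<lambda>x. x) program_presents"
  obtain c where "program_presents c (rewr_lts eval_rules)"
    using program_presents_rewr_lts by blast
  with D cover_WSTS_rewr_lts have
    "eval D [c, x, y] (if coverable (rewr_lts eval_rules) x y then 1 else 0)" for x y
    unfolding decides_coverability_def by (force simp: rewr_lts_def)
  from this[of "prod_encode (_, 0)" 0]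
  have "eval D [c, val (\<lambda>_. a) (PPair (PVar 0) PZero), 0]
      (if (a, 0) \<in> (rewr eval_rules)\<^sup>* then 1 else 0)" for a
    by (simp add: coverable_rewr_lts)
  then show False
    by (rule undecidable_rewr)
qed

section \<open>Regular programs over counters\<close>

text \<open>Regular expressions over machine instructions. Their relational semantics lets counter
  routines be specified and combined without mentioning control states.\<close>

datatype prog = Op counter_op "nat list" | Seq prog prog | Alt prog prog | Star prog

type_synonym store = "nat \<Rightarrow> nat"

fun act :: "counter_op \<Rightarrow> store \<Rightarrow> store \<Rightarrow> bool" where
  "act (Inc i) \<sigma> \<tau> \<longleftrightarrow> \<tau> = \<sigma>(i := Suc (\<sigma> i))"
| "act (Dec i) \<sigma> \<tau> \<longleftrightarrow> 0 < \<sigma> i \<and> \<tau> = \<sigma>(i := \<sigma> i - 1)"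
| "act Noop \<sigma> \<tau> \<longleftrightarrow> \<tau> = \<sigma>"

primrec rel :: "prog \<Rightarrow> (store \<times> store) set" where
  "rel (Op c Z) = {(\<sigma>, \<tau>). (\<forall>i\<in>set Z. \<sigma> i = 0) \<and> act c \<sigma> \<tau>}"
| "rel (Seq p q) = rel p O rel q"
| "rel (Alt p q) = rel p \<union> rel q"
| "rel (Star p) = (rel p)\<^sup>*"

text \<open>
  The control states of the machine for a program are the continuation stacks that can arise
  while it runs. There are finitely many of them, as in the construction of an automaton from the
  partial derivatives of a regular expression.
\<close>

fun succs :: "prog list \<Rightarrow> (counter_op \<times> nat list \<times> prog list) list" where
  "succs [] = []"
| "succs (Op c Z # K) = [(c, Z, K)]"
| "succs (Seq p q # K) = [(Noop, [], p # q # K)]"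
| "succs (Alt p q # K) = [(Noop, [], p # K), (Noop, [], q # K)]"
| "succs (Star p # K) = [(Noop, [], K), (Noop, [], p # Star p # K)]"

primrec conts :: "prog \<Rightarrow> prog list \<Rightarrow> prog list set" where
  "conts (Op c Z) K = {Op c Z # K}"
| "conts (Seq p q) K = {Seq p q # K} \<union> conts p (q # K) \<union> conts q K"
| "conts (Alt p q) K = {Alt p q # K} \<union> conts p K \<union> conts q K"
| "conts (Star p) K = {Star p # K} \<union> conts p (Star p # K)"

lemma finite_conts: "finite (conts p K)"
  by (induction p arbitrary: K) auto

lemma Cons_in_conts: "p # K \<in> conts p K"
  by (cases p) auto

text \<open>Finishing a subprogram exposes its own continuation, which is again a stack of the
  enclosing program or \<open>K\<close> itself.\<close>

lemma succs_conts:
  "K' \<in> conts p K \<Longrightarrow> (c, Z, K'') \<in> set (succs K') \<Longrightarrow> K'' \<in> insert K (conts p K)"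
proof (induction p arbitrary: K)
  case (Seq p q)
  then show ?case using Cons_in_conts[of p "q # K"] Cons_in_conts[of q K] by fastforce
next
  case (Alt p q)
  then show ?case using Cons_in_conts[of p K] Cons_in_conts[of q K] by fastforce
next
  case (Star p)
  then show ?case using Cons_in_conts[of p "Star p # K"] by fastforce
qed auto

primrec uses :: "nat \<Rightarrow> prog \<Rightarrow> bool" where
  "uses d (Op c Z) \<longleftrightarrow> c \<in> counter_ops d \<and> set Z \<subseteq> {..<d}"
| "uses d (Seq p q) \<longleftrightarrow> uses d p \<and> uses d q"
| "uses d (Alt p q) \<longleftrightarrow> uses d p \<and> uses d q"
| "uses d (Star p) \<longleftrightarrow> uses d p"

lemma uses_mono: "uses d p \<Longrightarrow> d \<le> e \<Longrightarrow> uses e p"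
  by (induction p) (auto simp: counter_ops_def)

lemma ex_uses: "\<exists>d. uses d p"
proof (induction p)
  case (Op c Z)
  have "\<exists>d. c \<in> counter_ops d"
    by (cases c) (auto simp: counter_ops_def)
  then obtain d where d: "c \<in> counter_ops d" ..
  obtain e where "set Z \<subseteq> {..<e}"
    using finite_nat_set_iff_bounded[of "set Z"] by auto
  with d have "uses (max d e) (Op c Z)"
    by (auto simp: counter_ops_def)
  then show ?case ..
next
  case (Seq p q)
  then obtain d e where "uses d p" "uses e q" by blast
  then have "uses (max d e) (Seq p q)" by (auto intro: uses_mono)
  then show ?case ..
next
  case (Alt p q)
  then obtain d e where "uses d p" "uses e q" by blast
  then have "uses (max d e) (Alt p q)" by (auto intro: uses_mono)
  then show ?case ..
qed auto

lemma uses_conts: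
  "K' \<in> conts p K \<Longrightarrow> uses d p \<Longrightarrow> list_all (uses d) K \<Longrightarrow> list_all (uses d) K'"
  by (induction p arbitrary: K) force+

lemma uses_succs:
  "(c, Z, K') \<in> set (succs K) \<Longrightarrow> list_all (uses d) K \<Longrightarrow>
    c \<in> counter_ops d \<and> set Z \<subseteq> {..<d}"
  by (cases K rule: succs.cases) (auto simp: counter_ops_def)

section \<open>Runs of continuation stacks against the relational semantics\<close>

definition small :: "((prog list \<times> store) \<times> (prog list \<times> store)) set" where
  "small = {((K, \<sigma>), (K', \<tau>)) |K \<sigma> K' \<tau>.
    \<exists>c Z. (c, Z, K') \<in> set (succs K) \<and> (\<forall>i\<in>set Z. \<sigma> i = 0) \<and> act c \<sigma> \<tau>}"

lemma small_iff:
  "((K, \<sigma>), (K', \<tau>)) \<in> small \<longleftrightarrow>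
    (\<exists>c Z. (c, Z, K') \<in> set (succs K) \<and> (\<forall>i\<in>set Z. \<sigma> i = 0) \<and> act c \<sigma> \<tau>)"
  by (simp add: small_def)

lemma small_Noop: "(Noop, [], K') \<in> set (succs K) \<Longrightarrow> ((K, \<sigma>), (K', \<sigma>)) \<in> small"
  unfolding small_iff by (intro exI[of _ Noop] exI[of _ "[]"]) simp

lemma small_complete: "(\<sigma>, \<tau>) \<in> rel p \<Longrightarrow> ((p # K, \<sigma>), (K, \<tau>)) \<in> small\<^sup>*"
proof (induction p arbitrary: K \<sigma> \<tau>)
  case (Op c Z)
  then show ?case by (intro r_into_rtrancl) (auto simp: small_iff)
next
  case (Seq p q)
  then obtain \<rho> where "(\<sigma>, \<rho>) \<in> rel p" "(\<rho>, \<tau>) \<in> rel q" by auto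
  note rtrancl_trans[OF Seq.IH(1)[OF this(1)] Seq.IH(2)[OF this(2)]]
  moreover have "((Seq p q # K, \<sigma>), (p # q # K, \<sigma>)) \<in> small"
    by (simp add: small_Noop)
  ultimately show ?case
    by (rule converse_rtrancl_into_rtrancl[rotated])
next
  case (Alt p q)
  have "((Alt p q # K, \<sigma>), (p # K, \<sigma>)) \<in> small" "((Alt p q # K, \<sigma>), (q # K, \<sigma>)) \<in> small"
    by (simp_all add: small_Noop)
  with Alt show ?case
    by (auto intro: converse_rtrancl_into_rtrancl)
next
  case (Star p)
  from Star.prems have "(\<sigma>, \<tau>) \<in> (rel p)\<^sup>*" by simp
  then show ?case
  proof (induction rule: converse_rtrancl_induct)
    case base
    show ?case by (intro r_into_rtrancl small_Noop) simp
  next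
    case (step \<rho> \<rho>')
    have "((Star p # K, \<rho>), (p # Star p # K, \<rho>)) \<in> small"
      by (simp add: small_Noop)
    from converse_rtrancl_into_rtrancl[OF this
        rtrancl_trans[OF Star.IH[OF step.hyps(1)] step.IH]]
    show ?case .
  qed
qed

primrec rels :: "prog list \<Rightarrow> (store \<times> store) set" where
  "rels [] = Id"
| "rels (p # K) = rel p O rels K"

text \<open>Read backwards, each step prefixes the relation of the remaining stack with the effect
  of one instruction.\<close>

lemma small_sound:
  assumes "((K, \<sigma>), (K', \<tau>)) \<in> small\<^sup>*"
  shows "(\<tau>, \<upsilon>) \<in> rels K' \<Longrightarrow> (\<sigma>, \<upsilon>) \<in> rels K"
  using assms
proof (induction rule: converse_rtrancl_induct2)
  case (step K \<sigma> K'' \<rho>)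
  from step.hyps(1) step.IH[OF step.prems] show ?case
    by (cases K rule: succs.cases)
      (auto simp: small_iff, (meson converse_rtrancl_into_rtrancl relcomp.relcompI)+)
qed

lemma small_rel: "(([p], \<sigma>), ([], \<tau>)) \<in> small\<^sup>* \<longleftrightarrow> (\<sigma>, \<tau>) \<in> rel p"
  using small_complete small_sound[of "[p]" \<sigma> "[]" \<tau> \<tau>] by auto

section \<open>Counter machines for regular programs\<close>

lemma ex_mono_subseq: "\<exists>r :: nat \<Rightarrow> nat. strict_mono r \<and> mono (\<lambda>i. (s :: nat \<Rightarrow> nat) (r i))"
proof -
  \<comment> \<open>Each later index is the first minimiser of \<open>s\<close> behind the previous
    index. The tails shrink, so these minima never decrease.\<close>
  define r where "r = rec_nat (LEAST i. \<forall>j. s i \<le> s j)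
    (\<lambda>_ k. LEAST i. k < i \<and> (\<forall>j>k. s i \<le> s j))"
  have ex: "\<exists>i>k. \<forall>j>k. s i \<le> s j" for k
  proof -
    obtain i where "k < i" "s i = (LEAST n. \<exists>i>k. s i = n)"
      using LeastI_ex[of "\<lambda>n. \<exists>i>k. s i = n"] by auto
    then show ?thesis
      by (metis (mono_tags, lifting) Least_le)
  qed
  have Suc: "r n < r (Suc n)" "\<And>j. r n < j \<Longrightarrow> s (r (Suc n)) \<le> s j" for n
    using LeastI_ex[OF ex[of "r n"]] by (auto simp: r_def)
  have mono: "strict_mono r"
    using Suc(1) by (rule strict_mono_Suc_iff[THEN iffD2, OF allI])
  have le: "s (r (Suc n)) \<le> s (r (Suc (Suc n)))" for n
    using Suc(1)[of n] Suc(1)[of "Suc n"] Suc(2)[of n "r (Suc (Suc n))"] by simp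
  have "strict_mono (\<lambda>i. r (Suc i))"
    using Suc(1) by (simp add: strict_mono_Suc_iff)
  moreover have "mono (\<lambda>i. s (r (Suc i)))"
    using le by (simp add: mono_iff_le_Suc)
  ultimately show ?thesis
    by (intro exI[of _ "\<lambda>i. r (Suc i)"] conjI)
qed

text \<open>Induction on the dimension: a subsequence monotone in the first coordinate is thinned
  out further for the others, and thinning preserves monotonicity.\<close>

lemma dickson_subseq:
  assumes "\<And>i. length (s i) = d"
  shows "\<exists>r :: nat \<Rightarrow> nat. strict_mono r \<and> (\<forall>i j. i \<le> j \<longrightarrow> list_all2 (\<le>) (s (r i)) (s (r j) :: nat list))"
  using assms
proof (induction d arbitrary: s)
  case 0
  then show ?case by (intro exI[of _ id]) (simp add: strict_mono_def)
next
  case (Suc d)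
  obtain r :: "nat \<Rightarrow> nat" where r: "strict_mono r" "mono (\<lambda>i. hd (s (r i)))"
    using ex_mono_subseq[of "\<lambda>i. hd (s i)"] by blast
  obtain q :: "nat \<Rightarrow> nat" where q: "strict_mono q"
    "\<And>i j. i \<le> j \<Longrightarrow> list_all2 (\<le>) (tl (s (r (q i)))) (tl (s (r (q j))))"
    using Suc.IH[of "\<lambda>i. tl (s (r i))"] Suc.prems by auto
  have "list_all2 (\<le>) (s (r (q i))) (s (r (q j)))" if "i \<le> j" for i j
  proof -
    have ne: "s k \<noteq> []" for k
      using Suc.prems[of k] by auto
    have "hd (s (r (q i))) \<le> hd (s (r (q j)))"
      using r(2) q(1) that by (auto dest: monoD strict_mono_mono)
    with q(2)[OF that] show ?thesis
      using list_all2_Cons[THEN iffD2] list.collapse[OF ne] by metis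
  qed
  then show ?case
    using r(1) q(1) by (intro exI[of _ "\<lambda>i. r (q i)"]) (auto simp: strict_mono_def)
qed

lemma wqo_cm_lts: "wqo_on (states (cm_lts M)) (leq (cm_lts M))"
proof -
  have "\<exists>i j. i < j \<and> leq (cm_lts M) (s i) (s j)" if s: "range s \<subseteq> cm_configs M" for s :: "nat \<Rightarrow> _"
  proof -
    \<comment> \<open>The control state enters once as itself and once subtracted from
      \<open>ncontrol M\<close>, so the componentwise order on codes forces equal control
      states.\<close>
    define code where "code c = fst c # (ncontrol M - fst c) # snd c" for c :: "nat \<times> nat list"
    have s': "fst (s i) < ncontrol M" "length (snd (s i)) = ncounters M" for i
      using s by (auto simp: cm_configs_def image_subset_iff case_prod_unfold)
    then obtain r :: "nat \<Rightarrow> nat" where r: "strict_mono r"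
      "\<And>i j. i \<le> j \<Longrightarrow> list_all2 (\<le>) (code (s (r i))) (code (s (r j)))"
      using dickson_subseq[of "\<lambda>i. code (s i)" "Suc (Suc (ncounters M))"] by (auto simp: code_def)
    from r(2)[of 0 1] s'[of "r 0"] s'[of "r 1"] have "leq (cm_lts M) (s (r 0)) (s (r 1))"
      by (auto simp: code_def cm_lts_def case_prod_unfold)
    with r(1) show ?thesis
      by (metis strict_mono_less zero_less_one)
  qed
  moreover have "quasi_order_on (cm_configs M) (leq (cm_lts M))"
    unfolding quasi_order_on_def cm_lts_def
    by (auto intro!: reflp_onI transp_onI list_all2_refl elim: list_all2_trans[rotated])
  ultimately show ?thesis
    by (simp add: wqo_on_def) (simp add: cm_lts_def)
qed

section \<open>Cover-WSTS from machines with a stuck start state\<close>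

lemma finite_apply_op: "finite {w. apply_op c v w}"
  by (cases c) auto

lemma apply_op_length: "apply_op c v w \<Longrightarrow> length w = length v"
  by (cases c) auto

lemma cover_WSTS_cm_lts:
  assumes wf: "wf_cm M" and start: "\<And>c Z q. (start M, c, Z, q) \<notin> set (rules M)"
  shows "cover_WSTS (cm_lts M)"
proof -
  have "finite {y. (x, y) \<in> step_rel (cm_lts M)}" for x
  proof (rule finite_subset)
    show "{y. (x, y) \<in> step_rel (cm_lts M)} \<subseteq>
        (\<Union>(q, c, Z, q') \<in> set (rules M). {q'} \<times> {w. apply_op c (snd x) w})"
      by (force simp: step_rel_def cm_lts_def)
    show "finite (\<Union>(q, c, Z, q') \<in> set (rules M). {q'} \<times> {w. apply_op c (snd x) w})"
      using finite_apply_op by auto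
  qed
  then have "finitely_branching (cm_lts M)"
    by (simp add: finitely_branching_def)
  moreover have "ordered_lts (cm_lts M)"
  proof -
    have "finite (alphabet (cm_lts M))"
      by (simp add: cm_lts_def counter_ops_def)
    moreover have "transitions (cm_lts M) \<subseteq>
        states (cm_lts M) \<times> alphabet (cm_lts M) \<times> states (cm_lts M)"
      using wf by (fastforce simp: cm_lts_def cm_configs_def wf_cm_def dest: apply_op_length)
    moreover have "init (cm_lts M) \<in> states (cm_lts M)"
      using wf by (simp add: cm_lts_def cm_configs_def wf_cm_def)
    ultimately show ?thesis
      using wqo_cm_lts[of M] by (simp add: ordered_lts_def wqo_on_def)
  qed
  moreover have "cover_monotone (cm_lts M)"
  proof -
    have stuck: "((start M, v), y) \<notin> step_rel (cm_lts M)" for v y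
      using start by (auto simp: step_rel_def cm_lts_def)
    have "y = init (cm_lts M)" if "(init (cm_lts M), y) \<in> (step_rel (cm_lts M))\<^sup>*" for y
      using that
    proof (cases rule: converse_rtranclE)
      case (step z)
      with stuck show ?thesis by (simp add: cm_lts_def)
    qed simp
    then have "Post_star (cm_lts M) (init (cm_lts M)) = {init (cm_lts M)}"
      by (auto simp: Post_star_def)
    then have down: "fst y = start M" if "y \<in> down (cm_lts M) (Post_star (cm_lts M) (init (cm_lts M)))"
      for y
      using that by (auto simp: down_def cm_lts_def)
    show ?thesis
      unfolding cover_monotone_def
    proof (intro ballI impI, elim conjE)
      fix y1 x1 x2
      assume y1: "y1 \<in> down (cm_lts M) (Post_star (cm_lts M) (init (cm_lts M)))"
        and le: "leq (cm_lts M) x1 y1" and st: "(x1, x2) \<in> step_rel (cm_lts M)"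
      \<comment> \<open>The order preserves control states, so \<open>x1\<close> is stuck as well
        and the assumed step from it cannot exist.\<close>
      from le have "fst x1 = fst y1"
        by (auto simp: cm_lts_def)
      with down[OF y1] st stuck[of "snd x1" x2] show "\<exists>y2. (y1, y2) \<in> (step_rel (cm_lts M))\<^sup>* \<and> leq (cm_lts M) x2 y2"
        by (metis prod.collapse)
    qed
  qed
  ultimately show ?thesis
    using wqo_cm_lts by (simp add: cover_WSTS_def)
qed

section \<open>Compiling a program into a machine\<close>

definition vec :: "nat \<Rightarrow> store \<Rightarrow> nat list" where
  "vec d \<sigma> = map \<sigma> [0..<d]"

lemma length_vec [simp]: "length (vec d \<sigma>) = d"
  by (simp add: vec_def)

lemma nth_vec [simp]: "i < d \<Longrightarrow> vec d \<sigma> ! i = \<sigma> i"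
  by (simp add: vec_def)

lemma vec_upd: "(vec d \<sigma>)[i := n] = vec d (\<sigma>(i := n))"
  by (rule nth_equalityI) (auto simp: nth_list_update)

lemma apply_op_vec:
  "c \<in> counter_ops d \<Longrightarrow> apply_op c (vec d \<sigma>) w \<longleftrightarrow> (\<exists>\<tau>. w = vec d \<tau> \<and> act c \<sigma> \<tau>)"
  by (cases c) (auto simp: counter_ops_def vec_upd)

definition machine :: "(prog list \<Rightarrow> nat) \<Rightarrow> prog list list \<Rightarrow> nat \<Rightarrow> counter_machine" where
  "machine f C d =
    \<lparr>ncontrol = length C, ncounters = d,
     rules = concat (map (\<lambda>K. map (\<lambda>(c, Z, K'). (f K, c, Z, f K')) (succs K)) C),
     start = f []\<rparr>"

lemma set_rules_machine:
  "set (rules (machine f C d)) = {(f K, c, Z, f K') |K c Z K'. K \<in> set C \<and> (c, Z, K') \<in> set (succs K)}"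
  by (auto simp: machine_def) force

text \<open>
  The start state is the empty stack, which has no transitions. So cover-monotonicity holds
  vacuously, while the runs from the other control states are those of the program.
\<close>

lemma machine_for_prog:
  obtains M q where "wf_cm M" "cover_WSTS (cm_lts M)" "0 < ncounters M" "q < ncontrol M"
    "\<And>\<sigma>. coverable (cm_lts M) (q, vec (ncounters M) \<sigma>) (init (cm_lts M)) \<longleftrightarrow>
      (\<exists>\<tau>. (\<sigma>, \<tau>) \<in> rel p)"
proof -
  obtain d' where "uses d' p" using ex_uses by blast
  \<comment> \<open>One counter is added so that counter 0 surely exists to hold the input.\<close>
  define d where "d = Suc d'"
  have d: "uses d p" "0 < d"
    using \<open>uses d' p\<close> by (auto simp: d_def intro: uses_mono)
  obtain C where C: "set C = insert [] (conts p [])" "distinct C"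
    using finite_distinct_list[of "insert [] (conts p [])"] finite_conts by blast
  obtain f where f: "bij_betw f (set C) {..<length C}"
    using ex_bij_betw_finite_nat[of "set C"] C(2) by (auto simp: distinct_card atLeast0LessThan)
  have f_less: "f K < length C" if "K \<in> set C" for K
    using f that by (auto simp: bij_betw_def)
  have f_eq: "f K = f K' \<longleftrightarrow> K = K'" if "K \<in> set C" "K' \<in> set C" for K K'
    using f that by (auto simp: bij_betw_def inj_on_eq_iff)
  have closed: "K' \<in> set C" if "K \<in> set C" "(c, Z, K') \<in> set (succs K)" for K c Z K'
    using that succs_conts[of K p "[]"] by (auto simp: C(1))
  have ops: "c \<in> counter_ops d \<and> set Z \<subseteq> {..<d}" if "K \<in> set C" "(c, Z, K') \<in> set (succs K)" for K c Z K'
  proof (rule uses_succs[OF that(2)])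
    show "list_all (uses d) K"
      using that(1) uses_conts[of K p "[]" d] d(1) by (auto simp: C(1))
  qed
  define M where "M = machine f C d"
  have sel: "ncontrol M = length C" "ncounters M = d" "start M = f []"
    by (simp_all add: M_def machine_def)
  have rule_iff: "(f K, c, Z, q) \<in> set (rules M) \<longleftrightarrow> (\<exists>K'. q = f K' \<and> (c, Z, K') \<in> set (succs K))"
    if "K \<in> set C" for K c Z q
    unfolding M_def set_rules_machine using that by (auto simp: f_eq)
  have step_iff: "((f K, vec d \<sigma>), y) \<in> step_rel (cm_lts M) \<longleftrightarrow>
      (\<exists>K' \<tau>. y = (f K', vec d \<tau>) \<and> ((K, \<sigma>), (K', \<tau>)) \<in> small)" if K: "K \<in> set C" for K \<sigma> y
  proof -
    have "((f K, vec d \<sigma>), y) \<in> step_rel (cm_lts M) \<longleftrightarrow>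
        (\<exists>c Z q w. (f K, c, Z, q) \<in> set (rules M) \<and> (\<forall>i\<in>set Z. vec d \<sigma> ! i = 0) \<and>
          apply_op c (vec d \<sigma>) w \<and> y = (q, w))"
      by (auto simp: step_rel_def cm_lts_def sel)
    also have "\<dots> \<longleftrightarrow> (\<exists>c Z K' w. (c, Z, K') \<in> set (succs K) \<and> (\<forall>i\<in>set Z. vec d \<sigma> ! i = 0) \<and>
          apply_op c (vec d \<sigma>) w \<and> y = (f K', w))"
      using rule_iff[OF K] by blast
    also have "\<dots> \<longleftrightarrow> (\<exists>c Z K' \<tau>. (c, Z, K') \<in> set (succs K) \<and> (\<forall>i\<in>set Z. \<sigma> i = 0) \<and>
          act c \<sigma> \<tau> \<and> y = (f K', vec d \<tau>))"
    proof -
      have zero: "(\<forall>i\<in>set Z. vec d \<sigma> ! i = 0) \<longleftrightarrow> (\<forall>i\<in>set Z. \<sigma> i = 0)"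
        and op: "apply_op c (vec d \<sigma>) w \<longleftrightarrow> (\<exists>\<tau>. w = vec d \<tau> \<and> act c \<sigma> \<tau>)"
        if "(c, Z, K') \<in> set (succs K)" for c Z K' w
        using ops[OF K that] by (auto simp: apply_op_vec subset_iff)
      show ?thesis
        by (simp add: zero op cong: conj_cong) blast
    qed
    finally show ?thesis
      unfolding small_iff by blast
  qed
  have sound: "\<exists>K' \<tau>. K' \<in> set C \<and> y = (f K', vec d \<tau>) \<and> (([p], \<sigma>), (K', \<tau>)) \<in> small\<^sup>*"
    if "((f [p], vec d \<sigma>), y) \<in> (step_rel (cm_lts M))\<^sup>*" for \<sigma> y
    using that
  proof induction
    case base
    show ?case
      by (intro exI[of _ "[p]"] exI[of _ \<sigma>]) (simp add: C(1) Cons_in_conts)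
  next
    case (step y z)
    then obtain K \<tau> where K: "K \<in> set C" "y = (f K, vec d \<tau>)" "(([p], \<sigma>), (K, \<tau>)) \<in> small\<^sup>*"
      by blast
    from step.hyps(2)[unfolded K(2)] obtain K' \<upsilon> where K': "z = (f K', vec d \<upsilon>)" "((K, \<tau>), (K', \<upsilon>)) \<in> small"
      using step_iff[OF K(1)] by blast
    moreover have "K' \<in> set C"
      using K'(2) K(1) closed by (auto simp: small_iff)
    ultimately show ?case
      using rtrancl_into_rtrancl[OF K(3) K'(2)] by blast
  qed
  have complete: "K \<in> set C \<and> ((f [p], vec d \<sigma>), (f K, vec d \<tau>)) \<in> (step_rel (cm_lts M))\<^sup>*"
    if "(([p], \<sigma>), (K, \<tau>)) \<in> small\<^sup>*" for \<sigma> K \<tau>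
    using that
  proof (induction rule: rtrancl_induct2)
    case refl
    show ?case by (simp add: C(1) Cons_in_conts)
  next
    case (step K \<tau> K' \<upsilon>)
    have K: "K \<in> set C" using step.IH by blast
    from step.hyps(2) have "((f K, vec d \<tau>), (f K', vec d \<upsilon>)) \<in> step_rel (cm_lts M)"
      unfolding step_iff[OF K] by blast
    moreover have "K' \<in> set C"
      using step.hyps(2) closed[OF K] by (auto simp: small_iff)
    ultimately show ?case
      using rtrancl_into_rtrancl[OF conjunct2[OF step.IH]] by blast
  qed
  have nil: "[] \<in> set C" by (simp add: C(1))
  have wf: "wf_cm M"
    unfolding wf_cm_def sel
  proof (intro conjI ballI)
    show "f [] < length C" by (rule f_less[OF nil])
    show "case x of (q, c, Z, q') \<Rightarrow>
        q < length C \<and> q' < length C \<and> c \<in> counter_ops d \<and> set Z \<subseteq> {..<d}"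
      if "x \<in> set (rules M)" for x
      using that f_less closed ops by (clarsimp simp: M_def set_rules_machine)
  qed
  moreover have "cover_WSTS (cm_lts M)"
  proof (rule cover_WSTS_cm_lts[OF wf])
    show "(start M, c, Z, q) \<notin> set (rules M)" for c Z q
      using nil by (auto simp: sel) (auto simp: M_def set_rules_machine f_eq)
  qed
  moreover have "0 < ncounters M" using d(2) by (simp add: sel)
  moreover have "f [p] < ncontrol M"
    by (simp add: sel f_less C(1) Cons_in_conts)
  \<comment> \<open>The initial configuration has all counters zero, so covering it means reaching
    the control state \<open>f []\<close> with any counter values.\<close>
  moreover have "coverable (cm_lts M) (f [p], vec (ncounters M) \<sigma>) (init (cm_lts M)) \<longleftrightarrow>
      (\<exists>\<tau>. (\<sigma>, \<tau>) \<in> rel p)" for \<sigma>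
  proof
    assume "coverable (cm_lts M) (f [p], vec (ncounters M) \<sigma>) (init (cm_lts M))"
    then obtain v where "((f [p], vec d \<sigma>), (f [], v)) \<in> (step_rel (cm_lts M))\<^sup>*"
      by (auto simp: coverable_def down_def Post_star_def sel) (auto simp: cm_lts_def sel)
    from sound[OF this] obtain \<tau> where "(([p], \<sigma>), ([], \<tau>)) \<in> small\<^sup>*"
      using f_eq nil by auto
    then show "\<exists>\<tau>. (\<sigma>, \<tau>) \<in> rel p"
      by (auto simp: small_rel)
  next
    assume "\<exists>\<tau>. (\<sigma>, \<tau>) \<in> rel p"
    then obtain \<tau> where "((f [p], vec d \<sigma>), (f [], vec d \<tau>)) \<in> (step_rel (cm_lts M))\<^sup>*"
      using complete by (auto simp: small_rel[symmetric])
    moreover have "leq (cm_lts M) (init (cm_lts M)) (f [], vec d \<tau>)"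
      by (simp add: cm_lts_def sel list_all2_conv_all_nth)
    moreover have "init (cm_lts M) \<in> states (cm_lts M)"
      using f_less[OF nil] by (simp add: cm_lts_def cm_configs_def sel)
    ultimately show "coverable (cm_lts M) (f [p], vec (ncounters M) \<sigma>) (init (cm_lts M))"
      by (auto simp: coverable_def down_def Post_star_def sel)
  qed
  ultimately show thesis by (rule that)
qed

section \<open>Rewriting with counters\<close>

lemma rel_Seq_iff: "(\<sigma>, \<tau>) \<in> rel (Seq p q) \<longleftrightarrow> (\<exists>\<rho>. (\<sigma>, \<rho>) \<in> rel p \<and> (\<rho>, \<tau>) \<in> rel q)"
  by auto

section \<open>Loops made exact by zero tests\<close>

definition shift :: "nat list \<Rightarrow> nat list \<Rightarrow> nat \<Rightarrow> store \<Rightarrow> store" where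
  "shift xs ys n \<sigma> = (\<lambda>i. if i \<in> set xs then \<sigma> i - n else if i \<in> set ys then \<sigma> i + n else \<sigma> i)"

definition incs :: "nat list \<Rightarrow> prog" where
  "incs ys = foldr (\<lambda>i. Seq (Op (Inc i) [])) ys (Op Noop [])"

definition transfer :: "nat list \<Rightarrow> nat list \<Rightarrow> prog" where
  "transfer xs ys = foldr (\<lambda>i. Seq (Op (Dec i) [])) xs (incs ys)"

text \<open>The final zero test fixes the number of rounds, so several sources are emptied only if
  they are equal: this is the equality test. With \<open>xs\<close> empty the number of rounds is
  arbitrary: this is the guess.\<close>

definition drain :: "nat list \<Rightarrow> nat list \<Rightarrow> prog" where
  "drain xs ys = Seq (Star (transfer xs ys)) (Op Noop xs)"

lemma rel_incs: "distinct ys \<Longrightarrow> (\<sigma>, \<tau>) \<in> rel (incs ys) \<longleftrightarrow> \<tau> = shift [] ys 1 \<sigma>"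
proof (induction ys arbitrary: \<sigma>)
  case Nil
  show ?case by (auto simp: incs_def shift_def)
next
  case (Cons y ys)
  have "(\<sigma>, \<tau>) \<in> rel (incs (y # ys)) \<longleftrightarrow> (\<sigma>(y := Suc (\<sigma> y)), \<tau>) \<in> rel (incs ys)"
    by (auto simp: incs_def)
  also have "\<dots> \<longleftrightarrow> \<tau> = shift [] ys 1 (\<sigma>(y := Suc (\<sigma> y)))"
    using Cons.prems by (intro Cons.IH) simp
  also have "shift [] ys 1 (\<sigma>(y := Suc (\<sigma> y))) = shift [] (y # ys) 1 \<sigma>"
    using Cons.prems by (auto simp: shift_def)
  finally show ?case .
qed

lemma rel_transfer:
  "distinct (xs @ ys) \<Longrightarrow>
    (\<sigma>, \<tau>) \<in> rel (transfer xs ys) \<longleftrightarrow> (\<forall>i\<in>set xs. 0 < \<sigma> i) \<and> \<tau> = shift xs ys 1 \<sigma>"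
proof (induction xs arbitrary: \<sigma>)
  case Nil
  then show ?case by (simp add: transfer_def rel_incs)
next
  case (Cons x xs)
  have "(\<sigma>, \<tau>) \<in> rel (transfer (x # xs) ys) \<longleftrightarrow>
      0 < \<sigma> x \<and> (\<sigma>(x := \<sigma> x - 1), \<tau>) \<in> rel (transfer xs ys)"
    by (auto simp: transfer_def)
  also have "(\<sigma>(x := \<sigma> x - 1), \<tau>) \<in> rel (transfer xs ys) \<longleftrightarrow>
      (\<forall>i\<in>set xs. 0 < (\<sigma>(x := \<sigma> x - 1)) i) \<and> \<tau> = shift xs ys 1 (\<sigma>(x := \<sigma> x - 1))"
    using Cons.prems by (intro Cons.IH) simp
  also have "(\<forall>i\<in>set xs. 0 < (\<sigma>(x := \<sigma> x - 1)) i) \<longleftrightarrow> (\<forall>i\<in>set xs. 0 < \<sigma> i)"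
    using Cons.prems by auto
  also have "shift xs ys 1 (\<sigma>(x := \<sigma> x - 1)) = shift (x # xs) ys 1 \<sigma>"
    using Cons.prems by (auto simp: shift_def)
  finally show ?case by auto
qed

lemma rel_drain:
  assumes "distinct (xs @ ys)"
  shows "(\<sigma>, \<tau>) \<in> rel (drain xs ys) \<longleftrightarrow> (\<exists>n. (\<forall>i\<in>set xs. \<sigma> i = n) \<and> \<tau> = shift xs ys n \<sigma>)"
proof -
  have shift_Suc: "shift xs ys 1 (shift xs ys n \<sigma>) = shift xs ys (Suc n) \<sigma>" for n
    using assms by (auto simp: shift_def)
  have "\<exists>n. (\<forall>i\<in>set xs. n \<le> \<sigma> i) \<and> \<tau> = shift xs ys n \<sigma>"
    if "(\<sigma>, \<tau>) \<in> (rel (transfer xs ys))\<^sup>*" for \<tau>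
    using that
  proof induction
    case base
    have "\<sigma> = shift xs ys 0 \<sigma>" by (auto simp: shift_def)
    then show ?case by blast
  next
    case (step \<tau> \<upsilon>)
    then obtain n where n: "\<forall>i\<in>set xs. n \<le> \<sigma> i" "\<tau> = shift xs ys n \<sigma>" by blast
    from step.hyps(2) have "\<forall>i\<in>set xs. 0 < \<tau> i" "\<upsilon> = shift xs ys (Suc n) \<sigma>"
      unfolding rel_transfer[OF assms] n(2) shift_Suc by auto
    moreover from this(1) n have "\<forall>i\<in>set xs. Suc n \<le> \<sigma> i"
      by (auto simp: shift_def)
    ultimately show ?case by blast
  qed
  moreover have "(\<sigma>, shift xs ys n \<sigma>) \<in> (rel (transfer xs ys))\<^sup>*" if "\<forall>i\<in>set xs. n \<le> \<sigma> i" for n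
    using that
  proof (induction n)
    case 0
    have "\<sigma> = shift xs ys 0 \<sigma>" by (auto simp: shift_def)
    then show ?case by simp
  next
    case (Suc n)
    then have "(shift xs ys n \<sigma>, shift xs ys (Suc n) \<sigma>) \<in> rel (transfer xs ys)"
      unfolding rel_transfer[OF assms] shift_Suc
      by (auto simp: shift_def)
    moreover have "\<forall>i\<in>set xs. n \<le> \<sigma> i"
      using Suc.prems Suc_leD by blast
    then have "(\<sigma>, shift xs ys n \<sigma>) \<in> (rel (transfer xs ys))\<^sup>*"
      by (rule Suc.IH)
    ultimately show ?case
      by (rule rtrancl_into_rtrancl[rotated])
  qed
  ultimately have star: "(\<sigma>, \<tau>) \<in> rel (Star (transfer xs ys)) \<longleftrightarrow>
      (\<exists>n. (\<forall>i\<in>set xs. n \<le> \<sigma> i) \<and> \<tau> = shift xs ys n \<sigma>)" for \<tau>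
    by auto
  have "(\<sigma>, \<tau>) \<in> rel (drain xs ys) \<longleftrightarrow>
      (\<sigma>, \<tau>) \<in> rel (Star (transfer xs ys)) \<and> (\<forall>i\<in>set xs. \<tau> i = 0)"
    by (auto simp: drain_def)
  moreover have "(\<forall>i\<in>set xs. n \<le> \<sigma> i) \<and> (\<forall>i\<in>set xs. shift xs ys n \<sigma> i = 0) \<longleftrightarrow>
      (\<forall>i\<in>set xs. \<sigma> i = n)" for n
    unfolding ball_conj_distrib[symmetric] by (intro ball_cong) (auto simp: shift_def)
  ultimately show ?thesis
    unfolding star by blast
qed

text \<open>Counter form of \<open>prod_decode_Suc\<close>: an empty \<open>y\<close> ends the
  antidiagonal, and otherwise one unit moves from \<open>y\<close> to \<open>x\<close>.\<close>

definition next_pair :: "nat \<Rightarrow> nat \<Rightarrow> prog" where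
  "next_pair x y =
    Alt (Seq (Op Noop [y]) (Seq (drain [x] [y]) (Op (Inc y) []))) (transfer [y] [x])"

lemma rel_next_pair:
  assumes "x \<noteq> y" "(\<sigma> x, \<sigma> y) = prod_decode k"
  shows "(\<sigma>, \<tau>) \<in> rel (next_pair x y) \<longleftrightarrow>
    \<tau> = \<sigma>(x := fst (prod_decode (Suc k)), y := snd (prod_decode (Suc k)))"
proof -
  have "shift [x] [y] (\<sigma> x) \<sigma> = \<sigma>(x := 0, y := \<sigma> y + \<sigma> x)"
    using assms(1) by (intro ext) (simp add: shift_def)
  then have 1: "(\<sigma>, \<rho>) \<in> rel (drain [x] [y]) \<longleftrightarrow> \<rho> = \<sigma>(x := 0, y := \<sigma> y + \<sigma> x)" for \<rho>
    using assms(1) by (simp add: rel_drain)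
  have "shift [y] [x] 1 \<sigma> = \<sigma>(x := Suc (\<sigma> x), y := \<sigma> y - 1)"
    using assms(1) by (intro ext) (simp add: shift_def)
  then have 2: "(\<sigma>, \<tau>) \<in> rel (transfer [y] [x]) \<longleftrightarrow>
      0 < \<sigma> y \<and> \<tau> = \<sigma>(x := Suc (\<sigma> x), y := \<sigma> y - 1)"
    using assms(1) by (simp add: rel_transfer)
  have "(\<sigma>, \<tau>) \<in> rel (next_pair x y) \<longleftrightarrow>
      \<sigma> y = 0 \<and> \<tau> = \<sigma>(x := 0, y := Suc (\<sigma> x)) \<or>
      0 < \<sigma> y \<and> \<tau> = \<sigma>(x := Suc (\<sigma> x), y := \<sigma> y - 1)"
    unfolding next_pair_def rel.simps(3) Un_iff rel_Seq_iff 2 by (auto simp: 1)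
  then show ?thesis
    by (auto simp: prod_decode_Suc assms(2)[symmetric])
qed

text \<open>Counts \<open>z\<close> up while \<open>(x, y)\<close> walks through all pairs in the order of their codes.\<close>

definition guess_pair :: "nat \<Rightarrow> nat \<Rightarrow> nat \<Rightarrow> prog" where
  "guess_pair z x y = Star (Seq (Op (Inc z) []) (next_pair x y))"

lemma rel_guess_pair:
  assumes "distinct [z, x, y]" "\<sigma> z = 0" "\<sigma> x = 0" "\<sigma> y = 0"
  shows "(\<sigma>, \<tau>) \<in> rel (guess_pair z x y) \<longleftrightarrow>
    (\<exists>m n. \<tau> = \<sigma>(z := prod_encode (m, n), x := m, y := n))"
proof -
  \<comment> \<open>\<open>T k\<close> is the store after \<open>k\<close> rounds. A round is
    deterministic, so only the number of rounds is guessed.\<close>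
  define T where "T k = \<sigma>(z := k, x := fst (prod_decode k), y := snd (prod_decode k))" for k
  let ?R = "rel (Seq (Op (Inc z) []) (next_pair x y))"
  have "prod_decode 0 = (0, 0)"
    using prod_encode_inverse[of "(0, 0)"] by (simp add: prod_encode_def)
  then have T0: "T 0 = \<sigma>"
    using assms by (auto simp: T_def)
  have step: "(T k, \<tau>) \<in> ?R \<longleftrightarrow> \<tau> = T (Suc k)" for k \<tau>
  proof -
    have "(T k, \<tau>) \<in> ?R \<longleftrightarrow> ((T k)(z := Suc k), \<tau>) \<in> rel (next_pair x y)"
      using assms by (auto simp: T_def)
    also have "\<dots> \<longleftrightarrow> \<tau> = (T k)(z := Suc k, x := fst (prod_decode (Suc k)), y := snd (prod_decode (Suc k)))"
      using assms by (intro rel_next_pair) (auto simp: T_def)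
    also have "(T k)(z := Suc k, x := fst (prod_decode (Suc k)), y := snd (prod_decode (Suc k))) =
        T (Suc k)"
      using assms by (auto simp: T_def fun_eq_iff)
    finally show ?thesis .
  qed
  have "(\<sigma>, \<tau>) \<in> ?R\<^sup>* \<longleftrightarrow> (\<exists>k. \<tau> = T k)"
  proof
    show "\<exists>k. \<tau> = T k" if "(\<sigma>, \<tau>) \<in> ?R\<^sup>*"
      using that by induction (use T0 step in blast)+
    have "(\<sigma>, T k) \<in> ?R\<^sup>*" for k
    proof (induction k)
      case (Suc k)
      with step[of k "T (Suc k)"] show ?case by (meson rtrancl_into_rtrancl)
    qed (simp add: T0)
    then show "(\<sigma>, \<tau>) \<in> ?R\<^sup>*" if "\<exists>k. \<tau> = T k"
      using that by blast
  qed
  also have "\<dots> \<longleftrightarrow> (\<exists>m n. \<tau> = \<sigma>(z := prod_encode (m, n), x := m, y := n))"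
  proof safe
    show "\<exists>m n. T k = \<sigma>(z := prod_encode (m, n), x := m, y := n)" for k
      by (intro exI[of _ "fst (prod_decode k)"] exI[of _ "snd (prod_decode k)"]) (simp add: T_def)
    show "\<exists>k. \<sigma>(z := prod_encode (m, n), x := m, y := n) = T k" for m n
      by (intro exI[of _ "prod_encode (m, n)"]) (simp add: T_def)
  qed
  finally show ?thesis
    by (simp add: guess_pair_def)
qed

text \<open>Counters from \<open>k\<close> on are zero scratch space, and the result goes to
  \<open>k\<close>. A variable is copied destructively into two counters, one of which restores it.
  For a pair, the code and its components are guessed together; the joint drains check the
  components against the computed ones and clear the scratch space.\<close>

primrec compute :: "nat \<Rightarrow> pat \<Rightarrow> prog" where
  "compute k (PVar i) = Seq (drain [i] [k, Suc k]) (drain [Suc k] [i])"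
| "compute k PZero = Op Noop []"
| "compute k (PSuc t) = Seq (compute k t) (Op (Inc k) [])"
| "compute k (PPair t u) =
    Seq (compute (k + 1) t) (Seq (compute (k + 2) u) (Seq (guess_pair k (k + 3) (k + 4))
      (Seq (drain [k + 1, k + 3] []) (drain [k + 2, k + 4] []))))"

lemma rel_compute:
  assumes "\<And>j. k \<le> j \<Longrightarrow> \<sigma> j = 0" "vars t \<subseteq> {..<k}"
  shows "(\<sigma>, \<tau>) \<in> rel (compute k t) \<longleftrightarrow> \<tau> = \<sigma>(k := val \<sigma> t)"
  using assms
proof (induction t arbitrary: k \<sigma> \<tau>)
  case (PVar i)
  let ?\<upsilon> = "\<sigma>(i := 0, k := \<sigma> i, Suc k := \<sigma> i)"
  from PVar.prems have i: "i < k" "\<sigma> k = 0" "\<sigma> (Suc k) = 0" by auto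
  then have "shift [i] [k, Suc k] (\<sigma> i) \<sigma> = ?\<upsilon>" "shift [Suc k] [i] (\<sigma> i) ?\<upsilon> = \<sigma>(k := \<sigma> i)"
    by (intro ext; simp add: shift_def)+
  with i have 1: "(\<sigma>, \<rho>) \<in> rel (drain [i] [k, Suc k]) \<longleftrightarrow> \<rho> = ?\<upsilon>"
    and 2: "(?\<upsilon>, \<rho>) \<in> rel (drain [Suc k] [i]) \<longleftrightarrow> \<rho> = \<sigma>(k := \<sigma> i)" for \<rho>
    by (simp_all add: rel_drain)
  then show ?case
    unfolding compute.simps rel_Seq_iff val.simps by (simp only: 1 2 simp_thms)
next
  case PZero
  have "\<sigma>(k := 0) = \<sigma>" using PZero.prems(1)[of k] by auto
  then show ?case by simp
next
  case (PSuc t)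
  then have 1: "(\<sigma>, \<upsilon>) \<in> rel (compute k t) \<longleftrightarrow> \<upsilon> = \<sigma>(k := val \<sigma> t)" for \<upsilon>
    by (intro PSuc.IH) auto
  have 2: "(\<sigma>(k := val \<sigma> t), \<tau>) \<in> rel (Op (Inc k) []) \<longleftrightarrow> \<tau> = \<sigma>(k := Suc (val \<sigma> t))"
    by (simp del: fun_upd_apply add: fun_upd_same)
  show ?case
    unfolding compute.simps rel_Seq_iff val.simps by (simp only: 1 2 simp_thms)
next
  case (PPair t u)
  let ?a = "val \<sigma> t" and ?b = "val \<sigma> u"
  define \<sigma>1 where "\<sigma>1 = \<sigma>(k + 1 := ?a)"
  define \<sigma>2 where "\<sigma>2 = \<sigma>1(k + 2 := ?b)"
  define \<sigma>3 where "\<sigma>3 m n = \<sigma>2(k := prod_encode (m, n), k + 3 := m, k + 4 := n)" for m n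
  note vars = PPair.prems(2)
  have 1: "(\<sigma>, \<upsilon>) \<in> rel (compute (k + 1) t) \<longleftrightarrow> \<upsilon> = \<sigma>1" for \<upsilon>
    unfolding \<sigma>1_def using PPair.prems by (intro PPair.IH(1)) auto
  have "(\<sigma>1, \<upsilon>) \<in> rel (compute (k + 2) u) \<longleftrightarrow> \<upsilon> = \<sigma>1(k + 2 := val \<sigma>1 u)" for \<upsilon>
    using PPair.prems by (intro PPair.IH(2)) (auto simp: \<sigma>1_def)
  \<comment> \<open>The value stored in \<open>k + 1\<close> lies outside the scratch space from
    \<open>k + 2\<close> on and is no variable of \<open>u\<close>.\<close>
  moreover have "val \<sigma>1 u = ?b"
    using vars by (intro val_cong) (auto simp: \<sigma>1_def)
  ultimately have 2: "(\<sigma>1, \<upsilon>) \<in> rel (compute (k + 2) u) \<longleftrightarrow> \<upsilon> = \<sigma>2" for \<upsilon>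
    by (simp add: \<sigma>2_def)
  have 3: "(\<sigma>2, \<upsilon>) \<in> rel (guess_pair k (k + 3) (k + 4)) \<longleftrightarrow> (\<exists>m n. \<upsilon> = \<sigma>3 m n)" for \<upsilon>
    unfolding \<sigma>3_def using PPair.prems(1)
    by (intro rel_guess_pair) (auto simp: \<sigma>1_def \<sigma>2_def)
  \<comment> \<open>The checks pass for exactly one guess, so the whole computation is a function of
    the store.\<close>
  have 4: "(\<exists>\<rho>. (\<sigma>3 m n, \<rho>) \<in> rel (drain [k + 1, k + 3] []) \<and>
      (\<rho>, \<tau>) \<in> rel (drain [k + 2, k + 4] [])) \<longleftrightarrow>
      m = ?a \<and> n = ?b \<and> \<tau> = \<sigma>(k := prod_encode (?a, ?b))" for m n
  proof -
    define \<rho>1 where "\<rho>1 = shift [k + 1, k + 3] [] ?a (\<sigma>3 m n)"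
    have "(\<sigma>3 m n) (k + 1) = ?a" "(\<sigma>3 m n) (k + 3) = m"
      by (simp_all add: \<sigma>1_def \<sigma>2_def \<sigma>3_def)
    then have d1: "(\<sigma>3 m n, \<rho>) \<in> rel (drain [k + 1, k + 3] []) \<longleftrightarrow> m = ?a \<and> \<rho> = \<rho>1" for \<rho>
      by (subst rel_drain) (auto simp: \<rho>1_def)
    have "\<rho>1 (k + 2) = ?b" "\<rho>1 (k + 4) = n"
      by (simp_all add: \<rho>1_def shift_def \<sigma>1_def \<sigma>2_def \<sigma>3_def)
    then have d2: "(\<rho>1, \<tau>) \<in> rel (drain [k + 2, k + 4] []) \<longleftrightarrow>
        n = ?b \<and> \<tau> = shift [k + 2, k + 4] [] ?b \<rho>1"
      by (subst rel_drain) auto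
    have "shift [k + 2, k + 4] [] ?b \<rho>1 = \<sigma>(k := prod_encode (?a, ?b))" if "m = ?a" "n = ?b"
    proof
      fix j
      show "shift [k + 2, k + 4] [] ?b \<rho>1 j = (\<sigma>(k := prod_encode (?a, ?b))) j"
        using PPair.prems(1)[of j] that
        by (auto simp: \<rho>1_def shift_def \<sigma>1_def \<sigma>2_def \<sigma>3_def)
    qed
    moreover have "(\<exists>\<rho>. (\<sigma>3 m n, \<rho>) \<in> rel (drain [k + 1, k + 3] []) \<and>
        (\<rho>, \<tau>) \<in> rel (drain [k + 2, k + 4] [])) \<longleftrightarrow>
        m = ?a \<and> n = ?b \<and> \<tau> = shift [k + 2, k + 4] [] ?b \<rho>1"
      by (simp only: d1 d2 conj_assoc ex_simps simp_thms)
    ultimately show ?thesis by (simp only: cong: conj_cong)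
  qed
  have "(\<sigma>, \<tau>) \<in> rel (compute k (PPair t u)) \<longleftrightarrow> (\<exists>m n \<rho>. (\<sigma>3 m n, \<rho>) \<in> rel (drain [k + 1, k + 3] []) \<and>
      (\<rho>, \<tau>) \<in> rel (drain [k + 2, k + 4] []))"
    unfolding compute.simps rel_Seq_iff by (simp only: 1 2 3 simp_thms) blast
  also have "\<dots> \<longleftrightarrow> \<tau> = \<sigma>(k := prod_encode (?a, ?b))"
    using 4 by blast
  finally show ?case unfolding val.simps .
qed

text \<open>Emptying a counter and refilling it by a loop of free length guesses its value.\<close>

definition scramble :: "nat list \<Rightarrow> prog" where
  "scramble is = foldr (\<lambda>i. Seq (Seq (drain [i] []) (drain [] [i]))) is (Op Noop [])"

lemma rel_scramble: "(\<sigma>, \<tau>) \<in> rel (scramble is) \<longleftrightarrow> (\<forall>i. i \<notin> set is \<longrightarrow> \<tau> i = \<sigma> i)"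
proof (induction "is" arbitrary: \<sigma>)
  case Nil
  show ?case by (auto simp: scramble_def)
next
  case (Cons i "is")
  have 1: "(\<sigma>, \<upsilon>) \<in> rel (Seq (drain [i] []) (drain [] [i])) \<longleftrightarrow> (\<exists>n. \<upsilon> = \<sigma>(i := n))" for \<upsilon>
  proof -
    have "shift [] [i] n (shift [i] [] (\<sigma> i) \<sigma>) = \<sigma>(i := n)" for n
      by (auto simp: shift_def)
    then show ?thesis
      unfolding rel_Seq_iff by (simp add: rel_drain)
  qed
  have "(\<sigma>, \<tau>) \<in> rel (scramble (i # is)) \<longleftrightarrow>
      (\<exists>\<upsilon>. (\<sigma>, \<upsilon>) \<in> rel (Seq (drain [i] []) (drain [] [i])) \<and> (\<upsilon>, \<tau>) \<in> rel (scramble is))"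
    unfolding scramble_def by (simp only: foldr.simps comp_apply rel_Seq_iff)
  also have "\<dots> \<longleftrightarrow> (\<exists>n. (\<sigma>(i := n), \<tau>) \<in> rel (scramble is))"
    unfolding 1 by blast
  also have "\<dots> \<longleftrightarrow> (\<forall>j. j \<notin> set (i # is) \<longrightarrow> \<tau> j = \<sigma> j)"
    unfolding Cons.IH by (auto intro!: exI[of _ "\<tau> i"])
  finally show ?case .
qed

text \<open>Counter 0 holds the number to be rewritten, counters 1 to \<open>N\<close> a guessed
  substitution. Draining counter 0 jointly with the computed left side is the matching test and
  clears both for the right side.\<close>

definition rule_prog :: "nat \<Rightarrow> pat \<times> pat \<Rightarrow> prog" where
  "rule_prog N p =
    Seq (scramble [1..<Suc N]) (Seq (compute (Suc N) (fst p)) (Seq (drain [0, Suc N] [])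
      (Seq (compute (Suc N) (snd p)) (drain [Suc N] [0]))))"

text \<open>The guessed substitution survives in the final store, and counter 0 is no variable, so
  both sides may be evaluated there.\<close>

lemma rel_rule_prog:
  assumes zero: "\<And>j. N < j \<Longrightarrow> \<sigma> j = 0" and vars: "vars l \<union> vars r \<subseteq> {1..N}"
  shows "(\<sigma>, \<tau>) \<in> rel (rule_prog N (l, r)) \<longleftrightarrow>
    (\<forall>j>N. \<tau> j = 0) \<and> \<sigma> 0 = val \<tau> l \<and> \<tau> 0 = val \<tau> r"
proof -
  let ?P = "Seq (compute (Suc N) l) (Seq (drain [0, Suc N] [])
    (Seq (compute (Suc N) r) (drain [Suc N] [0])))"
  have step: "(\<upsilon>, \<tau>) \<in> rel ?P \<longleftrightarrow> \<sigma> 0 = val \<upsilon> l \<and> \<tau> = \<upsilon>(0 := val \<upsilon> r)"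
    if \<upsilon>: "\<And>i. i \<notin> {1..N} \<Longrightarrow> \<upsilon> i = \<sigma> i" for \<upsilon>
  proof -
    have 1: "(\<upsilon>, \<rho>) \<in> rel (compute (Suc N) l) \<longleftrightarrow> \<rho> = \<upsilon>(Suc N := val \<upsilon> l)" for \<rho>
      using vars zero \<upsilon> by (intro rel_compute) auto
    have v: "(\<upsilon>(Suc N := val \<upsilon> l)) 0 = \<sigma> 0" "(\<upsilon>(Suc N := val \<upsilon> l)) (Suc N) = val \<upsilon> l"
      using \<upsilon>[of 0] by auto
    have "shift [0, Suc N] [] (val \<upsilon> l) (\<upsilon>(Suc N := val \<upsilon> l)) = \<upsilon>(0 := 0)" if "\<sigma> 0 = val \<upsilon> l"
      using that zero[of "Suc N"] \<upsilon>[of "Suc N"] \<upsilon>[of 0] by (intro ext) (simp add: shift_def)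
    then have 2: "(\<upsilon>(Suc N := val \<upsilon> l), \<rho>) \<in> rel (drain [0, Suc N] []) \<longleftrightarrow>
        \<sigma> 0 = val \<upsilon> l \<and> \<rho> = \<upsilon>(0 := 0)" for \<rho>
      by (subst rel_drain) (auto simp: v simp del: fun_upd_apply)
    have "val (\<upsilon>(0 := 0)) r = val \<upsilon> r"
      using vars by (intro val_cong) auto
    moreover have "(\<upsilon>(0 := 0), \<rho>) \<in> rel (compute (Suc N) r) \<longleftrightarrow>
        \<rho> = (\<upsilon>(0 := 0))(Suc N := val (\<upsilon>(0 := 0)) r)" for \<rho>
      using vars zero \<upsilon> by (intro rel_compute) auto
    ultimately have 3: "(\<upsilon>(0 := 0), \<rho>) \<in> rel (compute (Suc N) r) \<longleftrightarrow>
        \<rho> = \<upsilon>(0 := 0, Suc N := val \<upsilon> r)" for \<rho>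
      by simp
    have 4: "(\<upsilon>(0 := 0, Suc N := val \<upsilon> r), \<tau>) \<in> rel (drain [Suc N] [0]) \<longleftrightarrow>
        \<tau> = shift [Suc N] [0] (val \<upsilon> r) (\<upsilon>(0 := 0, Suc N := val \<upsilon> r))"
      by (simp add: rel_drain)
    have 5: "shift [Suc N] [0] (val \<upsilon> r) (\<upsilon>(0 := 0, Suc N := val \<upsilon> r)) = \<upsilon>(0 := val \<upsilon> r)"
      using zero[of "Suc N"] \<upsilon>[of "Suc N"] by (intro ext) (simp add: shift_def)
    show ?thesis
      unfolding rel_Seq_iff by (simp only: 1 2 3 4 5 conj_assoc ex_simps simp_thms)
  qed
  have "(\<sigma>, \<tau>) \<in> rel (rule_prog N (l, r)) \<longleftrightarrow>
      (\<exists>\<upsilon>. (\<forall>i. i \<notin> {1..N} \<longrightarrow> \<upsilon> i = \<sigma> i) \<and> \<sigma> 0 = val \<upsilon> l \<and> \<tau> = \<upsilon>(0 := val \<upsilon> r))"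
  proof -
    have "(\<sigma>, \<upsilon>) \<in> rel (scramble [1..<Suc N]) \<longleftrightarrow> (\<forall>i. i \<notin> {1..N} \<longrightarrow> \<upsilon> i = \<sigma> i)" for \<upsilon>
      by (auto simp: rel_scramble)
    then have "(\<sigma>, \<tau>) \<in> rel (rule_prog N (l, r)) \<longleftrightarrow>
        (\<exists>\<upsilon>. (\<forall>i. i \<notin> {1..N} \<longrightarrow> \<upsilon> i = \<sigma> i) \<and> (\<upsilon>, \<tau>) \<in> rel ?P)"
      unfolding rule_prog_def fst_conv snd_conv rel_Seq_iff[of \<sigma> \<tau> "scramble _"] by (simp only:)
    also have "\<dots> \<longleftrightarrow>
        (\<exists>\<upsilon>. (\<forall>i. i \<notin> {1..N} \<longrightarrow> \<upsilon> i = \<sigma> i) \<and> \<sigma> 0 = val \<upsilon> l \<and> \<tau> = \<upsilon>(0 := val \<upsilon> r))"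
      using step by (intro ex_cong1 conj_cong) (rule refl, blast)
    finally show ?thesis .
  qed
  also have "\<dots> \<longleftrightarrow> (\<forall>j>N. \<tau> j = 0) \<and> \<sigma> 0 = val \<tau> l \<and> \<tau> 0 = val \<tau> r"
  proof
    assume "\<exists>\<upsilon>. (\<forall>i. i \<notin> {1..N} \<longrightarrow> \<upsilon> i = \<sigma> i) \<and> \<sigma> 0 = val \<upsilon> l \<and> \<tau> = \<upsilon>(0 := val \<upsilon> r)"
    then obtain \<upsilon> where \<upsilon>: "\<And>i. i \<notin> {1..N} \<Longrightarrow> \<upsilon> i = \<sigma> i" "\<sigma> 0 = val \<upsilon> l"
      "\<tau> = \<upsilon>(0 := val \<upsilon> r)"
      by blast
    have "val \<tau> l = val \<upsilon> l" "val \<tau> r = val \<upsilon> r"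
      unfolding \<upsilon>(3) using vars by (auto intro!: val_cong)
    moreover have "\<tau> j = 0" if "N < j" for j
      unfolding \<upsilon>(3) using that zero[of j] \<upsilon>(1)[of j] by auto
    ultimately show "(\<forall>j>N. \<tau> j = 0) \<and> \<sigma> 0 = val \<tau> l \<and> \<tau> 0 = val \<tau> r"
      using \<upsilon>(2,3) by auto
  next
    assume \<tau>: "(\<forall>j>N. \<tau> j = 0) \<and> \<sigma> 0 = val \<tau> l \<and> \<tau> 0 = val \<tau> r"
    \<comment> \<open>The store right after the guess is recovered by putting the old number back
      into counter 0.\<close>
    let ?\<upsilon> = "\<tau>(0 := \<sigma> 0)"
    have v: "val ?\<upsilon> l = val \<tau> l" "val ?\<upsilon> r = val \<tau> r"
      using vars by (auto intro!: val_cong)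
    have "?\<upsilon> i = \<sigma> i" if "i \<notin> {1..N}" for i
      using that zero[of i] \<tau> by (cases "i = 0") auto
    moreover have "\<tau> = ?\<upsilon>(0 := val ?\<upsilon> r)"
      unfolding v using \<tau> by auto
    moreover have "\<sigma> 0 = val ?\<upsilon> l"
      unfolding v using \<tau> by blast
    ultimately show "\<exists>\<upsilon>. (\<forall>i. i \<notin> {1..N} \<longrightarrow> \<upsilon> i = \<sigma> i) \<and> \<sigma> 0 = val \<upsilon> l \<and> \<tau> = \<upsilon>(0 := val \<upsilon> r)"
      by (intro exI[of _ ?\<upsilon>] conjI allI impI)
  qed
  finally show ?thesis .
qed

text \<open>The base \<open>Op Noop []\<close> of the choice adds only the identity, which the
  iteration absorbs. The last zero test accepts exactly the empty goal list.\<close>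

definition rewr_prog :: "nat \<Rightarrow> (pat \<times> pat) list \<Rightarrow> prog" where
  "rewr_prog N R =
    Seq (Star (foldr Alt (map (rule_prog N) R) (Op Noop []))) (Op Noop [0])"

lemma rel_foldr_Alt: "rel (foldr Alt ps (Op Noop [])) = \<Union>(rel ` set ps) \<union> Id"
  by (induction ps) auto

lemma rel_rewr_prog:
  assumes zero: "\<And>j. N < j \<Longrightarrow> \<sigma> j = 0"
    and vars: "\<And>l r. (l, r) \<in> set R \<Longrightarrow> vars l \<union> vars r \<subseteq> {1..N}"
  shows "(\<exists>\<tau>. (\<sigma>, \<tau>) \<in> rel (rewr_prog N R)) \<longleftrightarrow> (\<sigma> 0, 0) \<in> (rewr R)\<^sup>*"
proof -
  let ?S = "\<Union>(rel ` rule_prog N ` set R) \<union> Id"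
  have "(\<forall>j>N. \<tau> j = 0) \<and> (\<sigma> 0, \<tau> 0) \<in> (rewr R)\<^sup>*" if "(\<sigma>, \<tau>) \<in> ?S\<^sup>*" for \<tau>
    using that
  proof induction
    case (step \<tau> \<upsilon>)
    show ?case
    proof (cases "\<upsilon> = \<tau>")
      case False
      with step.hyps(2) obtain l r where lr: "(l, r) \<in> set R" "(\<tau>, \<upsilon>) \<in> rel (rule_prog N (l, r))"
        by auto
      have "(\<forall>j>N. \<upsilon> j = 0) \<and> \<tau> 0 = val \<upsilon> l \<and> \<upsilon> 0 = val \<upsilon> r"
        using rel_rule_prog[OF _ vars[OF lr(1)], of \<tau> \<upsilon>] step.IH lr(2) by blast
      moreover from this lr(1) have "(\<tau> 0, \<upsilon> 0) \<in> rewr R"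
        unfolding rewr_def by blast
      ultimately show ?thesis
        using step.IH by (meson rtrancl_into_rtrancl)
    qed (use step.IH in simp)
  qed (simp add: zero)
  moreover have "\<exists>\<tau>. (\<sigma>, \<tau>) \<in> ?S\<^sup>* \<and> (\<forall>j>N. \<tau> j = 0) \<and> \<tau> 0 = b" if "(\<sigma> 0, b) \<in> (rewr R)\<^sup>*" for b
    using that
  proof induction
    case base
    show ?case using zero by blast
  next
    case (step b c)
    then obtain \<tau> where \<tau>: "(\<sigma>, \<tau>) \<in> ?S\<^sup>*" "\<forall>j>N. \<tau> j = 0" "\<tau> 0 = b"
      by blast
    from step.hyps(2) obtain \<rho> l r where lr: "(l, r) \<in> set R" "b = val \<rho> l" "c = val \<rho> r"
      by (auto simp: rewr_def)
    \<comment> \<open>Only the part of the substitution on 1 to \<open>N\<close> is stored, so the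
      higher counters stay zero for the next round.\<close>
    define \<upsilon> where "\<upsilon> i = (if i = 0 then c else if i \<le> N then \<rho> i else 0)" for i
    have "val \<upsilon> l = b" "val \<upsilon> r = c"
      unfolding lr using vars[OF lr(1)] by (auto intro!: val_cong simp: \<upsilon>_def)
    then have "(\<tau>, \<upsilon>) \<in> rel (rule_prog N (l, r))"
      using rel_rule_prog[OF _ vars[OF lr(1)], of \<tau> \<upsilon>] \<tau> by (auto simp: \<upsilon>_def)
    then have "(\<tau>, \<upsilon>) \<in> ?S"
      using lr(1) by blast
    then have "(\<sigma>, \<upsilon>) \<in> ?S\<^sup>*"
      using \<tau>(1) by (rule rtrancl_into_rtrancl[rotated])
    moreover have "\<forall>j>N. \<upsilon> j = 0" "\<upsilon> 0 = c"
      by (simp_all add: \<upsilon>_def)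
    ultimately show ?case by blast
  qed
  moreover have "(\<exists>\<tau>. (\<sigma>, \<tau>) \<in> rel (rewr_prog N R)) \<longleftrightarrow> (\<exists>\<tau>. (\<sigma>, \<tau>) \<in> ?S\<^sup>* \<and> \<tau> 0 = 0)"
    by (auto simp: rewr_prog_def rel_foldr_Alt)
  ultimately show ?thesis
    by metis
qed

lemma undecidable_cm_presents: "\<not> decides_coverability D config_code cm_presents"
proof
  assume D: "decides_coverability D config_code cm_presents"
  \<comment> \<open>The bound 7 is the largest variable index in \<open>eval_rules\<close>.\<close>
  obtain M q where M: "wf_cm M" "cover_WSTS (cm_lts M)" "0 < ncounters M" "q < ncontrol M"
    "\<And>\<sigma>. coverable (cm_lts M) (q, vec (ncounters M) \<sigma>) (init (cm_lts M)) \<longleftrightarrow>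
      (\<exists>\<tau>. (\<sigma>, \<tau>) \<in> rel (rewr_prog 7 eval_rules))"
    by (rule machine_for_prog[of "rewr_prog 7 eval_rules"]) blast
  define d where "d = ncounters M - 1"
  have cov: "coverable (cm_lts M) (q, a # replicate d 0) (init (cm_lts M)) \<longleftrightarrow>
      (a, 0) \<in> (rewr eval_rules)\<^sup>*" for a
  proof -
    have "vec (ncounters M) ((\<lambda>_. 0)(0 := a)) = a # replicate d 0"
      using M(3) by (intro nth_equalityI) (auto simp: d_def nth_Cons split: nat.split)
    with M(5)[of "(\<lambda>_. 0)(0 := a)"] show ?thesis
      using rel_rewr_prog[of 7 "(\<lambda>_. 0)(0 := a)" eval_rules] vars_eval_rules by simp
  qed
  \<comment> \<open>All counters but counter 0 start at zero, so the tail of the configuration has a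
    constant code and can be a numeral pattern.\<close>
  define t where
    "t = PPair (pnum q) (pcons (PVar 0) (pnum (list_encode (replicate d 0))))"
  have "eval D [cm_code M, val (\<lambda>_. a) t, config_code (init (cm_lts M))]
      (if (a, 0) \<in> (rewr eval_rules)\<^sup>* then 1 else 0)" for a
  proof -
    have "cm_presents (cm_code M) (cm_lts M)"
      using M(1) by (auto simp: cm_presents_def)
    moreover have "(q, a # replicate d 0) \<in> states (cm_lts M)" "init (cm_lts M) \<in> states (cm_lts M)"
      using M by (auto simp: cm_lts_def cm_configs_def d_def wf_cm_def)
    moreover have "config_code (q, a # replicate d 0) = val (\<lambda>_. a) t"
      by (simp add: t_def)
    ultimately show ?thesis
      using D M(2) unfolding decides_coverability_def cov[symmetric] by metis
  qed
  then show False
    by (rule undecidable_rewr)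
qed

theorem theorem5p10:
  shows "\<not> (\<exists>D. decides_coverability D (\<lambda>x :: nat. x) program_presents) \<and>
         \<not> (\<exists>D. decides_coverability D config_code cm_presents)"
  using undecidable_program_presents undecidable_cm_presents by blast

end
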